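(* Let $(X,d)$ be a (nonempty) compact metric space and $\alpha:X\to X$ a continuous map that is a non-contracting local homeomorphism on $X_\alpha$ (i.e. the restriction $\alpha:X_\alpha\to X_\alpha$ is a non-contracting local homeomorphism). Then (i) $\gamma(\alpha)=0$ and thus $h(\alpha)=\omega(\alpha)$; (ii) $P(\alpha,\ln a)=\ell(\alpha,a)$ for every positive function $a\in C(X)$.
   Context: $M_\alpha(X)$ is the set of Borel $\alpha$-invariant probability measures on $X$. A point $x\in X$ is essential if every neighborhood $V$ of $x$ satisfies $\mu(V)>0$ for some $\mu\in M_\alpha(X)$; $X_\alpha$ is the (closed) set of essential points, and $\alpha(X_\alpha)=X_\alpha$. For $x\in X_\alpha$ put $\tilde\alpha^{-n}(x):=\alpha^{-n}(x)\cap X_\alpha$. A local homeomorphism is a map such that every point has an open neighborhood mapped homeomorphically onto an open set. A map $\alpha$ of a metric space into itself is non-contracting if there is $r>0$ such that $d(x,y)\le r$ implies $d(\alpha(x),\alpha(y))\ge d(x,y)$. Put $d_n(x,y):=\max_{0\le i\le n-1}d(\alpha^i(x),\alpha^i(y))$. A set $E\subset X$ is $(n,\varepsilon)$-spanning if for every $x\in X$ there is $y\in E$ with $d_n(x,y)<\varepsilon$; a set $E\subset X_\alpha$ is $(n,\varepsilon)$-spanning for $X_\alpha$ if for every $x\in X_\alpha$ there is $y\in E$ with $d_n(x,y)<\varepsilon$. Topological pressure (for positive $a\in C(X)$): $$P(\alpha,\ln a):=\ln\lim_{\varepsilon\to0}\limsup_{n\to\infty}\inf\Bigl\{\Bigl(\sum_{y\in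 E}\prod_{i=0}^{n-1}a(\alpha^i(y))\Bigr)^{1/n}: E\text{ is }(n,\varepsilon)\text{-spanning}\Bigr\};$$ topological entropy: $h(\alpha):=P(\alpha,0)$. Inverse rami-rate: $\omega(\alpha):=\ln\limsup_{n\to\infty}\sup_{x\in X_\alpha}|\tilde\alpha^{-n}(x)|^{1/n}$. Forward entropy: $\gamma(\alpha):=\ln\lim_{\varepsilon\to0}\limsup_{n\to\infty}\inf\{|\alpha^n(E)|^{1/n}: E\text{ is }(n,\varepsilon)\text{-spanning for }X_\alpha\}$. Essential spectral potential (for nonnegative $a$): $$\ell(\alpha,a):=\ln\lim_{n\to\infty}\sup_{x\in X_\alpha}\Bigl(\sum_{y\in\tilde\alpha^{-n}(x)}\prod_{i=0}^{n-1}a(\alpha^i(y))\Bigr)^{1/n},\qquad \ln0=-\infty.$$ *)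

theory Defs
  imports "HOL-Probability.Probability"
begin

section \<open>Invariant measures and essential points\<close>

text \<open>A compact metric space is given as a subset \<open>X\<close> of a type of class \<open>metric_space\<close>, with
  metric \<open>dist\<close>; a self-map of \<open>X\<close> is a function \<open>\<alpha>\<close> on the type that maps \<open>X\<close> into \<open>X\<close>, and only
  its values on \<open>X\<close> matter.\<close>

definition invariant_measures :: "'a::metric_space set \<Rightarrow> ('a \<Rightarrow> 'a) \<Rightarrow> 'a measure set" where
  "invariant_measures X \<alpha> =
     {\<mu>. sets \<mu> = sets (restrict_space borel X) \<and> prob_space \<mu> \<and>
         (\<forall>A\<in>sets \<mu>. emeasure \<mu> (\<alpha> -` A \<inter> X) = emeasure \<mu> A)}"

definition essential_points :: "'a::metric_space set \<Rightarrow> ('a \<Rightarrow> 'a) \<Rightarrow> 'a set" where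
  "essential_points X \<alpha> =
     {x\<in>X. \<forall>V. openin (top_of_set X) V \<and> x \<in> V \<longrightarrow>
              (\<exists>\<mu>\<in>invariant_measures X \<alpha>. measure \<mu> V > 0)}"

definition essential_preimage :: "'a::metric_space set \<Rightarrow> ('a \<Rightarrow> 'a) \<Rightarrow> nat \<Rightarrow> 'a \<Rightarrow> 'a set" where
  "essential_preimage X \<alpha> n x = {y\<in>X. (\<alpha> ^^ n) y = x} \<inter> essential_points X \<alpha>"


section \<open>Non-contracting local homeomorphisms\<close>

definition local_homeomorphism_on ::
  "'a::topological_space set \<Rightarrow> 'b::topological_space set \<Rightarrow> ('a \<Rightarrow> 'b) \<Rightarrow> bool" where
  "local_homeomorphism_on S T f \<longleftrightarrow>
     (\<forall>x\<in>S. \<exists>U g. openin (top_of_set S) U \<and> x \<in> U \<and> openin (top_of_set T) (f ` U) \<and>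
                  homeomorphism U (f ` U) f g)"

definition non_contracting_on :: "'a::metric_space set \<Rightarrow> ('a \<Rightarrow> 'a) \<Rightarrow> bool" where
  "non_contracting_on S f \<longleftrightarrow>
     (\<exists>r>0. \<forall>x\<in>S. \<forall>y\<in>S. dist x y \<le> r \<longrightarrow> dist (f x) (f y) \<ge> dist x y)"


section \<open>Extended-real arithmetic\<close>

text \<open>Sums over possibly infinite sets, their \<open>n\<close>-th roots and the limits of these are taken in
  \<open>[0, \<infinity>]\<close>, and the logarithm maps \<open>[0, \<infinity>]\<close> onto \<open>[-\<infinity>, \<infinity>]\<close>.\<close>

definition root_ennreal :: "nat \<Rightarrow> ennreal \<Rightarrow> ennreal" where
  "root_ennreal n x = (if x = \<infinity> then \<infinity> else ennreal (root n (enn2real x)))"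

definition ln_ennreal :: "ennreal \<Rightarrow> ereal" where
  "ln_ennreal x =
     (if x = 0 then -\<infinity> else if x = \<infinity> then \<infinity> else ereal (ln (enn2real x)))"

text \<open>Number of elements, with value \<open>\<infinity>\<close> on infinite sets.\<close>

definition ecard :: "'a set \<Rightarrow> ennreal" where
  "ecard S = emeasure (count_space UNIV) S"


section \<open>Pressure and entropy\<close>

text \<open>For \<open>n = 0\<close> the maximum is over the empty set and hence unspecified; everything below only
  depends on large \<open>n\<close>.\<close>

definition bowen_dist :: "('a::metric_space \<Rightarrow> 'a) \<Rightarrow> nat \<Rightarrow> 'a \<Rightarrow> 'a \<Rightarrow> real" where
  "bowen_dist \<alpha> n x y = Max ((\<lambda>i. dist ((\<alpha> ^^ i) x) ((\<alpha> ^^ i) y)) ` {..<n})"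

definition spanning :: "'a::metric_space set \<Rightarrow> ('a \<Rightarrow> 'a) \<Rightarrow> nat \<Rightarrow> real \<Rightarrow> 'a set \<Rightarrow> bool" where
  "spanning Y \<alpha> n \<epsilon> E \<longleftrightarrow> E \<subseteq> Y \<and> (\<forall>x\<in>Y. \<exists>y\<in>E. bowen_dist \<alpha> n x y < \<epsilon>)"

text \<open>The argument \<open>\<phi>\<close> is the potential \<open>ln a\<close>, so that the weight \<open>a\<close> is \<open>exp \<circ> \<phi>\<close>.\<close>

definition pressure :: "'a::metric_space set \<Rightarrow> ('a \<Rightarrow> 'a) \<Rightarrow> ('a \<Rightarrow> real) \<Rightarrow> ereal" where
  "pressure X \<alpha> \<phi> =
     ln_ennreal (Lim (at_right 0) (\<lambda>\<epsilon>. limsup (\<lambda>n.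
       INF E\<in>{E. spanning X \<alpha> n \<epsilon> E}.
         root_ennreal n (\<Sum>\<^sub>\<infinity>y\<in>E. ennreal (\<Prod>i<n. exp (\<phi> ((\<alpha> ^^ i) y)))))))"

definition entropy :: "'a::metric_space set \<Rightarrow> ('a \<Rightarrow> 'a) \<Rightarrow> ereal" where
  "entropy X \<alpha> = pressure X \<alpha> (\<lambda>x. 0)"

definition inverse_rami_rate :: "'a::metric_space set \<Rightarrow> ('a \<Rightarrow> 'a) \<Rightarrow> ereal" where
  "inverse_rami_rate X \<alpha> =
     ln_ennreal (limsup (\<lambda>n.
       SUP x\<in>essential_points X \<alpha>. root_ennreal n (ecard (essential_preimage X \<alpha> n x))))"

definition forward_entropy :: "'a::metric_space set \<Rightarrow> ('a \<Rightarrow> 'a) \<Rightarrow> ereal" where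
  "forward_entropy X \<alpha> =
     ln_ennreal (Lim (at_right 0) (\<lambda>\<epsilon>. limsup (\<lambda>n.
       INF E\<in>{E. spanning (essential_points X \<alpha>) \<alpha> n \<epsilon> E}.
         root_ennreal n (ecard ((\<alpha> ^^ n) ` E)))))"

definition essential_spectral_potential ::
  "'a::metric_space set \<Rightarrow> ('a \<Rightarrow> 'a) \<Rightarrow> ('a \<Rightarrow> real) \<Rightarrow> ereal" where
  "essential_spectral_potential X \<alpha> a =
     ln_ennreal (lim (\<lambda>n.
       SUP x\<in>essential_points X \<alpha>.
         root_ennreal n (\<Sum>\<^sub>\<infinity>y\<in>essential_preimage X \<alpha> n x.
           ennreal (\<Prod>i<n. a ((\<alpha> ^^ i) y)))))"

end

theory Submission
  imports Defs
begin

text \<open>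
  Write \<open>Y\<close> for the set of essential points and \<open>s\<^sub>n\<close> for the supremum of the weighted sums
  over the fibres of \<open>\<alpha>\<^sup>n\<close> on \<open>Y\<close>. Points of one such fibre are separated in the Bowen
  metric because \<open>\<alpha>\<close> is non-contracting, so every spanning set of \<open>X\<close> carries at least the weight
  \<open>s\<^sub>n\<close>, up to a factor \<open>exp (\<kappa> n)\<close>. Conversely, local inverses do not expand, so the
  preimages under \<open>\<alpha>\<^sup>m\<close> of a fixed finite net span \<open>Y\<close>; since the net does not depend on
  \<open>m\<close>, the forward entropy vanishes. To pass from \<open>Y\<close> to \<open>X\<close> no variational principle is
  needed: a limit of orbit averages that charged a compact set of inessential points would be an
  invariant measure charging it, hence orbits spend an asymptotically negligible time away from
  \<open>Y\<close>, uniformly in the starting point. Cutting orbits into blocks of length \<open>m\<close> that shadow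
  \<open>Y\<close> and a few exceptional steps bounds the pressure by \<open>s\<^sub>m\<close> to the power \<open>1/m\<close>, up to
  arbitrarily small errors, for every large \<open>m\<close>. Hence the limit superior and the limit
  inferior of these roots coincide with the exponential of the pressure.
\<close>

section \<open>Invariant measures from contents\<close>

lemma separate_compact_sets:
  fixes A B :: "'a::metric_space set"
  assumes "compact A" "compact B" "A \<inter> B = {}"
  obtains U V where "open U" "open V" "A \<subseteq> U" "B \<subseteq> V" "U \<inter> V = {}"
  using Hausdorff_space_compact_separation[of euclidean A B] assms
  by (auto simp: disjnt_def)

text \<open>The parts of \<open>C\<close> missed by \<open>V\<close> and by \<open>U\<close> are
  disjoint compact sets, so they have disjoint open neighbourhoods; removing these one at a time
  from \<open>C\<close> leaves the two pieces. This is what makes the inner content subadditive on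
  open sets.\<close>

lemma compact_subset_Un_split:
  fixes C :: "'a::metric_space set"
  assumes "compact C" "C \<subseteq> U \<union> V" "open U" "open V"
  obtains C1 C2 where "compact C1" "compact C2" "C1 \<subseteq> U" "C2 \<subseteq> V" "C = C1 \<union> C2"
proof -
  have "compact (C - V)" "compact (C - U)"
    using assms by (auto intro: compact_diff)
  moreover have "(C - V) \<inter> (C - U) = {}"
    using assms by auto
  ultimately obtain W1 W2 where W: "open W1" "open W2" "C - V \<subseteq> W1" "C - U \<subseteq> W2" "W1 \<inter> W2 = {}"
    by (rule separate_compact_sets)
  show thesis
  proof
    show "compact (C - W2)" "compact (C - W1)"
      using assms W by (auto intro: compact_diff)
  qed (use W in auto)
qed

text \<open>The content lives on all subsets of \<open>X\<close>, because limits of orbit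
  frequencies are taken for all sets at once. Countable additivity is then manufactured on the Borel
  sets.\<close>

locale compact_content =
  fixes X :: "'a::metric_space set" and m :: "'a set \<Rightarrow> ennreal"
  assumes compact_X: "compact X"
    and content_empty: "m {} = 0"
    and content_space: "m X = 1"
    and content_Un: "\<And>A B. A \<subseteq> X \<Longrightarrow> B \<subseteq> X \<Longrightarrow> A \<inter> B = {} \<Longrightarrow> m (A \<union> B) = m A + m B"
begin

text \<open>The content is only finitely additive, so its values on open sets are replaced by the
  suprema over compact subsets; compactness then yields countable subadditivity.\<close>

definition inner_content :: "'a set \<Rightarrow> ennreal" where
  "inner_content T = (SUP C\<in>{C. compact C \<and> C \<subseteq> X \<inter> T}. m C)"

definition outer_content :: "'a set \<Rightarrow> ennreal" where
  "outer_content A = (INF T\<in>{T. open T \<and> A \<subseteq> T}. inner_content T)"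

section \<open>The outer measure generated by a content\<close>

lemma content_mono: "A \<subseteq> B \<Longrightarrow> B \<subseteq> X \<Longrightarrow> m A \<le> m B"
  using content_Un[of A "B - A"] by (simp add: Un_absorb1 subset_trans[of A B X] subset_trans[of "B - A" B X])

lemma content_subadd:
  assumes "A \<subseteq> X" "B \<subseteq> X" shows "m (A \<union> B) \<le> m A + m B"
proof -
  have "m (A \<union> B) = m A + m (B - A)"
    using content_Un[of A "B - A"] assms by auto
  also have "\<dots> \<le> m A + m B"
    using assms by (intro add_left_mono content_mono) auto
  finally show ?thesis .
qed

lemma content_le_inner: "compact C \<Longrightarrow> C \<subseteq> X \<Longrightarrow> C \<subseteq> T \<Longrightarrow> m C \<le> inner_content T"
  unfolding inner_content_def by (intro SUP_upper) auto

lemma inner_leI: "(\<And>C. compact C \<Longrightarrow> C \<subseteq> X \<Longrightarrow> C \<subseteq> T \<Longrightarrow> m C \<le> c) \<Longrightarrow> inner_content T \<le> c"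
  unfolding inner_content_def by (intro SUP_least) auto

lemma inner_le_1: "inner_content T \<le> 1"
  using content_mono[of _ X] by (intro inner_leI) (auto simp: content_space)

lemma outer_le_inner: "open T \<Longrightarrow> A \<subseteq> T \<Longrightarrow> outer_content A \<le> inner_content T"
  unfolding outer_content_def by (intro INF_lower) auto

lemma outer_geI: "(\<And>T. open T \<Longrightarrow> A \<subseteq> T \<Longrightarrow> c \<le> inner_content T) \<Longrightarrow> c \<le> outer_content A"
  unfolding outer_content_def by (intro INF_greatest) auto

lemma outer_mono: "A \<subseteq> B \<Longrightarrow> outer_content A \<le> outer_content B"
  by (intro outer_geI outer_le_inner) auto

text \<open>On compact sets the passage to \<open>outer_content\<close> can only gain mass, as in
  the portmanteau theorem. This direction preserves lower bounds for limits of visit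
  frequencies.\<close>

lemma content_le_outer: "compact C \<Longrightarrow> C \<subseteq> X \<Longrightarrow> m C \<le> outer_content C"
  by (intro outer_geI content_le_inner) auto

lemma outer_space: "outer_content X = 1"
proof (rule antisym)
  show "outer_content X \<le> 1"
    using outer_le_inner[of UNIV X] inner_le_1[of UNIV] by auto
  show "1 \<le> outer_content X"
    using content_le_outer[of X] compact_X by (simp add: content_space)
qed

lemma inner_empty: "inner_content {} = 0"
proof -
  have "inner_content {} \<le> 0"
    by (rule inner_leI) (auto simp: content_empty)
  then show ?thesis by simp
qed

lemma outer_empty: "outer_content {} = 0"
  using outer_le_inner[of "{}" "{}"] by (simp add: inner_empty)

lemma inner_Un:
  assumes "open S" "open T"
  shows "inner_content (S \<union> T) \<le> inner_content S + inner_content T"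
proof (rule inner_leI)
  fix C assume C: "compact C" "C \<subseteq> X" "C \<subseteq> S \<union> T"
  obtain C1 C2 where D: "compact C1" "compact C2" "C1 \<subseteq> S" "C2 \<subseteq> T" "C = C1 \<union> C2"
    using compact_subset_Un_split[OF C(1,3) assms] .
  have "m C \<le> m C1 + m C2"
    unfolding D(5) using C D by (intro content_subadd) auto
  also have "\<dots> \<le> inner_content S + inner_content T"
    using C D by (intro add_mono content_le_inner) auto
  finally show "m C \<le> inner_content S + inner_content T" .
qed

lemma inner_UN_lessThan:
  fixes T :: "nat \<Rightarrow> 'a set"
  assumes "\<And>i. open (T i)"
  shows "inner_content (\<Union>i<n. T i) \<le> (\<Sum>i<n. inner_content (T i))"
proof (induction n)
  case 0
  show ?case by (simp add: inner_empty)
next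
  case (Suc n)
  have "inner_content (\<Union>i<Suc n. T i) = inner_content ((\<Union>i<n. T i) \<union> T n)"
    by (simp add: lessThan_Suc Un_commute)
  also have "\<dots> \<le> inner_content (\<Union>i<n. T i) + inner_content (T n)"
    using assms by (intro inner_Un) auto
  also have "\<dots> \<le> (\<Sum>i<Suc n. inner_content (T i))"
    using Suc.IH by (simp add: add_right_mono)
  finally show ?case .
qed

text \<open>A compact subset of the union already lies in finitely many of the sets, so the finite
  case suffices.\<close>

lemma inner_UN:
  fixes T :: "nat \<Rightarrow> 'a set"
  assumes "\<And>i. open (T i)"
  shows "inner_content (\<Union>i. T i) \<le> (\<Sum>i. inner_content (T i))"
proof (rule inner_leI)
  fix C assume C: "compact C" "C \<subseteq> X" "C \<subseteq> (\<Union>i. T i)"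
  obtain J where J: "finite J" "C \<subseteq> (\<Union>i\<in>J. T i)"
    by (rule compactE_image[OF C(1), of UNIV T]) (use assms C(3) in auto)
  then obtain n where "J \<subseteq> {..<n}"
    using finite_nat_iff_bounded by blast
  with J have "C \<subseteq> (\<Union>i<n. T i)" by blast
  then have "m C \<le> inner_content (\<Union>i<n. T i)"
    using C by (intro content_le_inner) auto
  also have "\<dots> \<le> (\<Sum>i<n. inner_content (T i))"
    using assms by (rule inner_UN_lessThan)
  also have "\<dots> \<le> (\<Sum>i. inner_content (T i))"
    by (intro sum_le_suminf) auto
  finally show "m C \<le> (\<Sum>i. inner_content (T i))" .
qed

lemma outer_measure_space_outer: "outer_measure_space (Pow X) outer_content"
  unfolding outer_measure_space_def
proof (intro conjI)
  show "positive (Pow X) outer_content"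
    by (simp add: positive_def outer_empty)
  show "increasing (Pow X) outer_content"
    by (simp add: increasing_def outer_mono)
  show "countably_subadditive (Pow X) outer_content"
  proof (simp add: countably_subadditive_def, safe)
    fix A :: "nat \<Rightarrow> 'a set"
    show "outer_content (\<Union>i. A i) \<le> (\<Sum>n. outer_content (A n))"
    proof (rule ennreal_le_epsilon)
      fix e :: real assume e: "0 < e" "(\<Sum>n. outer_content (A n)) < top"
      \<comment> \<open>Finiteness of the sum makes every term finite, so adding a positive amount
        is strict and some open set comes that close to the infimum. The allowances add up to
        \<open>e\<close>.\<close>
      then have *: "outer_content (A n) < outer_content (A n) + e * (1/2)^Suc n" for n
        by (auto simp add: less_top dest!: ennreal_suminf_lessD)
      have "\<exists>T. open T \<and> A n \<subseteq> T \<and> inner_content T \<le> outer_content (A n) + e * (1/2)^Suc n" for n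
        using *[of n] unfolding outer_content_def[of "A n"] INF_less_iff by (auto intro: less_imp_le)
      then obtain T where T: "\<And>n. open (T n)" "\<And>n. A n \<subseteq> T n"
          "\<And>n. inner_content (T n) \<le> outer_content (A n) + e * (1/2)^Suc n"
        by metis
      have "outer_content (\<Union>i. A i) \<le> inner_content (\<Union>i. T i)"
        using T by (intro outer_le_inner) auto
      also have "\<dots> \<le> (\<Sum>n. inner_content (T n))"
        using T by (intro inner_UN) auto
      also have "\<dots> \<le> (\<Sum>n. outer_content (A n) + e * (1/2) ^ Suc n)"
        using T by (intro suminf_le) auto
      also have "... = (\<Sum>n. outer_content (A n)) + (\<Sum>n. ennreal e * ennreal ((1/2) ^ Suc n))"
        using \<open>0 < e\<close> by (subst suminf_add[symmetric])
                         (auto simp del: ennreal_suminf_cmult simp add: ennreal_mult[symmetric])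
      also have "\<dots> = (\<Sum>n. outer_content (A n)) + e"
        unfolding ennreal_suminf_cmult
        by (subst suminf_ennreal_eq[OF zero_le_power power_half_series]) auto
      finally show "outer_content (\<Union>i. A i) \<le> (\<Sum>n. outer_content (A n)) + e" .
    qed
  qed
qed

text \<open>This is the nontrivial half of Caratheodory's criterion. Inside a neighbourhood
  \<open>W\<close> of \<open>A\<close>, the set \<open>W \<inter> T\<close> is exhausted by compact
  sets \<open>C\<close>, while \<open>A - T\<close> lies in the open set \<open>W - C\<close>;
  compact subsets of the latter are disjoint from \<open>C\<close>, so additivity of the content
  applies.\<close>

lemma outer_split_open:
  assumes T: "open T"
  shows "outer_content (A \<inter> T) + outer_content (A - T) \<le> outer_content A"
proof (rule outer_geI)
  fix W assume W: "open W" "A \<subseteq> W"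
  have 1: "m C + inner_content (W - C) \<le> inner_content W" if C: "compact C" "C \<subseteq> X" "C \<subseteq> W" for C
  proof -
    have "m C + inner_content (W - C) = (SUP L\<in>{L. compact L \<and> L \<subseteq> X \<inter> (W - C)}. m C + m L)"
      unfolding inner_content_def by (intro ennreal_SUP_add_right) auto
    also have "\<dots> \<le> inner_content W"
    proof (intro SUP_least)
      fix L assume L: "L \<in> {L. compact L \<and> L \<subseteq> X \<inter> (W - C)}"
      have "m C + m L = m (C \<union> L)"
        using C L by (intro content_Un[symmetric]) auto
      also have "\<dots> \<le> inner_content W"
        using C L by (intro content_le_inner compact_Un) auto
      finally show "m C + m L \<le> inner_content W" .
    qed
    finally show ?thesis .
  qed
  have "outer_content (A \<inter> T) + outer_content (A - T) \<le> inner_content (W \<inter> T) + outer_content (A - T)"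
    using W T by (intro add_right_mono outer_le_inner) auto
  also have "\<dots> = (SUP C\<in>{C. compact C \<and> C \<subseteq> X \<inter> (W \<inter> T)}. m C + outer_content (A - T))"
    unfolding inner_content_def by (intro ennreal_SUP_add_left[symmetric]) (auto simp: top_unique)
  also have "\<dots> \<le> inner_content W"
  proof (intro SUP_least)
    fix C assume C: "C \<in> {C. compact C \<and> C \<subseteq> X \<inter> (W \<inter> T)}"
    have "m C + outer_content (A - T) \<le> m C + inner_content (W - C)"
      using C W T by (intro add_left_mono outer_le_inner open_Diff compact_imp_closed) auto
    also have "\<dots> \<le> inner_content W"
      using C by (intro 1) auto
    finally show "m C + outer_content (A - T) \<le> inner_content W" .
  qed
  finally show "outer_content (A \<inter> T) + outer_content (A - T) \<le> inner_content W" .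
qed

text \<open>Caratheodory's construction gives a measure on the lambda system \<open>L\<close>, which
  contains the traces of open sets; transport along the identity then restricts it to the Borel sets
  of \<open>X\<close>.\<close>

lemma borel_measure_dominating_content:
  obtains \<mu> where "sets \<mu> = sets (restrict_space borel X)" "prob_space \<mu>"
    "\<And>A. A \<in> sets \<mu> \<Longrightarrow> emeasure \<mu> A = outer_content A"
proof -
  define L where "L = lambda_system X (Pow X) outer_content"
  have ms: "measure_space X L outer_content"
    unfolding L_def
    by (rule sigma_algebra.caratheodory_lemma[OF sigma_algebra_Pow outer_measure_space_outer])
  then have sa: "sigma_algebra X L" and pos: "positive L outer_content" and ca: "countably_additive L outer_content"
    by (auto simp: measure_space_def)
  interpret sigma_algebra X L by (rule sa)
  define \<mu>0 where "\<mu>0 = measure_of X L outer_content"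
  have sp: "space \<mu>0 = X" and st: "sets \<mu>0 = L"
    unfolding \<mu>0_def by (auto simp: space_measure_of_conv sets_measure_of_conv space_closed sigma_sets_eq)
  have em: "emeasure \<mu>0 A = outer_content A" if "A \<in> L" for A
    unfolding \<mu>0_def by (rule emeasure_measure_of_sigma[OF sa pos ca that])
  have open_L: "T \<inter> X \<in> L" if T: "open T" for T
    unfolding L_def lambda_system_def
  proof (clarify, intro conjI)
    show "\<forall>A\<in>Pow X. outer_content (T \<inter> X \<inter> A) + outer_content ((X - T \<inter> X) \<inter> A) = outer_content A"
    proof
      fix A assume A: "A \<in> Pow X"
      then have eq: "T \<inter> X \<inter> A = A \<inter> T" "(X - T \<inter> X) \<inter> A = A - T" by auto
      have sub: "subadditive (Pow X) outer_content"
        using outer_measure_space_outer unfolding outer_measure_space_def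
        by (intro ring_of_sets.countably_subadditive_subadditive)
          (auto intro: algebra.axioms(1) algebra_Pow)
      have "outer_content ((A \<inter> T) \<union> (A - T)) \<le> outer_content (A \<inter> T) + outer_content (A - T)"
        using A sub[unfolded subadditive_def, rule_format, of "A \<inter> T" "A - T"] by auto
      moreover have "(A \<inter> T) \<union> (A - T) = A" by auto
      ultimately show "outer_content (T \<inter> X \<inter> A) + outer_content ((X - T \<inter> X) \<inter> A) = outer_content A"
        unfolding eq using outer_split_open[OF T, of A] by (simp add: antisym)
    qed
  qed auto
  have "(\<lambda>x. x) \<in> borel_measurable \<mu>0"
    by (rule borel_measurableI) (use open_L in \<open>auto simp: sp st\<close>)
  then have meas: "(\<lambda>x. x) \<in> measurable \<mu>0 (restrict_space borel X)"
    by (intro measurable_restrict_space2) (auto simp: sp)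
  define \<mu> where "\<mu> = distr \<mu>0 (restrict_space borel X) (\<lambda>x. x)"
  have emu: "emeasure \<mu> A = outer_content A" if "A \<in> sets \<mu>" for A
  proof -
    from that have A: "A \<in> sets (restrict_space borel X)"
      by (simp add: \<mu>_def)
    then have "A \<subseteq> X"
      using sets.sets_into_space[OF A] by (simp add: space_restrict_space)
    then have eq: "(\<lambda>x. x) -` A \<inter> space \<mu>0 = A"
      by (auto simp: sp)
    moreover have "A \<in> L"
      using measurable_sets[OF meas A] unfolding eq st .
    ultimately show ?thesis
      unfolding \<mu>_def by (simp add: emeasure_distr[OF meas A] em)
  qed
  show thesis
  proof
    show sets: "sets \<mu> = sets (restrict_space borel X)"
      by (simp add: \<mu>_def)
    have "space \<mu> = X"
      by (simp add: \<mu>_def space_restrict_space)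
    then show "prob_space \<mu>"
      using emu[OF sets.top] by (intro prob_spaceI) (simp add: outer_space)
  qed (rule emu)
qed

text \<open>A compact set inside the preimage of an open \<open>T\<close> has compact image inside
  \<open>T\<close>, and it lies in the preimage of that image, so invariance of the content bounds
  its mass. Working with images of compact sets yields only one inequality.\<close>

lemma outer_vimage_le:
  assumes cont: "continuous_on X f" and sub: "f ` X \<subseteq> X"
    and inv: "\<And>A. A \<subseteq> X \<Longrightarrow> m (f -` A \<inter> X) = m A"
  shows "outer_content (f -` A \<inter> X) \<le> outer_content A"
proof (rule outer_geI)
  fix T assume T: "open T" "A \<subseteq> T"
  obtain T' where T': "open T'" "T' \<inter> X = f -` T \<inter> X"
    using cont T(1) unfolding continuous_on_open_invariant by auto
  have "outer_content (f -` A \<inter> X) \<le> inner_content T'"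
    using T T' by (intro outer_le_inner) auto
  also have "\<dots> \<le> inner_content T"
  proof (rule inner_leI)
    fix C assume C: "compact C" "C \<subseteq> X" "C \<subseteq> T'"
    have "m C \<le> m (f -` (f ` C) \<inter> X)"
      using C by (intro content_mono) auto
    also have "\<dots> = m (f ` C)"
      using C sub by (intro inv) auto
    also have "\<dots> \<le> inner_content T"
    proof (rule content_le_inner)
      show "compact (f ` C)"
        using C by (intro compact_continuous_image continuous_on_subset[OF cont]) auto
      show "f ` C \<subseteq> X"
        using C sub by blast
      show "f ` C \<subseteq> T"
        using C T' by blast
    qed
    finally show "m C \<le> inner_content T" .
  qed
  finally show "outer_content (f -` A \<inter> X) \<le> inner_content T" .
qed

lemma invariant_measure_dominating_content:
  assumes cont: "continuous_on X f" and sub: "f ` X \<subseteq> X"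
    and inv: "\<And>A. A \<subseteq> X \<Longrightarrow> m (f -` A \<inter> X) = m A"
  obtains \<mu> where "\<mu> \<in> invariant_measures X f"
    "\<And>C. compact C \<Longrightarrow> C \<subseteq> X \<Longrightarrow> m C \<le> emeasure \<mu> C"
proof -
  obtain \<mu> where \<mu>: "sets \<mu> = sets (restrict_space borel X)" "prob_space \<mu>"
      "\<And>A. A \<in> sets \<mu> \<Longrightarrow> emeasure \<mu> A = outer_content A"
    by (rule borel_measure_dominating_content) blast
  have space: "space \<mu> = X"
    using sets_eq_imp_space_eq[OF \<mu>(1)] by (simp add: space_restrict_space)
  interpret prob_space \<mu> by (rule \<mu>(2))
  have meas: "f -` A \<inter> X \<in> sets \<mu>" if A: "A \<in> sets \<mu>" for A
  proof -
    have "f \<in> borel_measurable (restrict_space borel X)"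
      by (rule borel_measurable_continuous_on_restrict[OF cont])
    then have "f \<in> measurable (restrict_space borel X) (restrict_space borel X)"
      using sub by (intro measurable_restrict_space2) (auto simp: space_restrict_space)
    from measurable_sets[OF this, of A] A show ?thesis
      by (simp add: \<mu>(1) space_restrict_space)
  qed
  have le: "prob (f -` A \<inter> X) \<le> prob A" if "A \<in> sets \<mu>" for A
    using outer_vimage_le[OF assms, of A] that meas[OF that]
    by (simp add: \<mu>(3)[symmetric] emeasure_eq_measure)
  have "emeasure \<mu> (f -` A \<inter> X) = emeasure \<mu> A" if A: "A \<in> sets \<mu>" for A
  proof -
    \<comment> \<open>The reverse inequality is the one just proved, applied to the complement; the
      total mass is 1.\<close>
    have "f -` (X - A) \<inter> X = X - (f -` A \<inter> X)"
      using sub by auto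
    then have "1 - prob (f -` A \<inter> X) \<le> 1 - prob A"
      using le[of "space \<mu> - A"] A meas[OF A] sets.compl_sets[OF A] prob_compl[OF A] prob_compl[OF meas[OF A]]
      by (auto simp: space)
    with le[OF A] show ?thesis
      by (simp add: emeasure_eq_measure)
  qed
  then have "\<mu> \<in> invariant_measures X f"
    using \<mu> by (simp add: invariant_measures_def)
  moreover have "m C \<le> emeasure \<mu> C" if C: "compact C" "C \<subseteq> X" for C
  proof -
    have "C \<in> sets (restrict_space borel X)"
      unfolding sets_restrict_space using C borel_closed[OF compact_imp_closed[OF C(1)]]
      by (intro image_eqI[of _ _ C]) auto
    then show ?thesis
      using content_le_outer[OF C] by (simp add: \<mu>)
  qed
  ultimately show thesis by (rule that)
qed

end


section \<open>Orbits visit inessential points rarely\<close>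

text \<open>The index set may be uncountable, so a convergent subsequence need not exist; Tychonoff's
  theorem provides a finer filter instead.\<close>

lemma tendsto_along_subfilter:
  fixes u :: "nat \<Rightarrow> 'b \<Rightarrow> real"
  assumes "\<And>k A. u k A \<in> {0..1}"
  obtains H m where "H \<noteq> bot" "H \<le> sequentially" "\<And>A. ((\<lambda>k. u k A) \<longlongrightarrow> m A) H"
proof -
  let ?K = "PiE UNIV (\<lambda>_::'b. {0..1::real})"
  have "compactin (product_topology (\<lambda>_. euclidean) UNIV) ?K"
    by (simp add: compactin_PiE)
  then have "compact ?K"
    by (simp add: euclidean_product_topology)
  moreover have "filtermap u sequentially \<noteq> bot"
    by (simp add: filtermap_bot_iff)
  moreover have "eventually (\<lambda>v. v \<in> ?K) (filtermap u sequentially)"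
    using assms by (auto simp: eventually_filtermap PiE_iff intro!: always_eventually)
  ultimately obtain m where m: "inf (nhds m) (filtermap u sequentially) \<noteq> bot"
    unfolding compact_filter by blast
  \<comment> \<open>The function \<open>m\<close> is a cluster point of \<open>u\<close> in the
    compact cube. Meeting \<open>sequentially\<close> with the pullback of its neighbourhoods forces
    convergence to \<open>m\<close>, and the cluster property keeps the filter proper.\<close>
  define H where "H = inf sequentially (filtercomap u (nhds m))"
  have "H \<noteq> bot"
  proof
    assume "H = bot"
    then have "eventually (\<lambda>_. False) H"
      by simp
    then obtain P Q where PQ: "eventually P sequentially" "eventually Q (filtercomap u (nhds m))"
        "\<And>k. P k \<Longrightarrow> Q k \<Longrightarrow> False"
      unfolding H_def eventually_inf by auto
    then obtain R where R: "eventually R (nhds m)" "\<And>k. R (u k) \<Longrightarrow> Q k"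
      unfolding eventually_filtercomap by auto
    have "eventually (\<lambda>v. \<not> R v) (filtermap u sequentially)"
      unfolding eventually_filtermap using PQ(1) by eventually_elim (use PQ R in blast)
    then have "eventually (\<lambda>_. False) (inf (nhds m) (filtermap u sequentially))"
      unfolding eventually_inf using R(1) by blast
    with m show False
      by (simp add: trivial_limit_def)
  qed
  moreover have "H \<le> sequentially"
    by (simp add: H_def)
  moreover have "((\<lambda>k. u k A) \<longlongrightarrow> m A) H" for A
  proof -
    have lim: "filterlim u (nhds m) H"
      by (rule filterlim_mono[OF filterlim_filtercomap order_refl]) (simp add: H_def)
    show ?thesis
    proof (rule topological_tendstoI)
      fix S :: "real set" assume S: "open S" "m A \<in> S"
      have "open ((\<lambda>v::'b \<Rightarrow> real. v A) -` S)"
        by (rule open_vimage[OF S(1) continuous_on_product_coordinates])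
      from topological_tendstoD[OF lim this] S(2) show "\<forall>\<^sub>F k in H. u k A \<in> S"
        by simp
    qed
  qed
  ultimately show thesis
    by (rule that)
qed

locale compact_system =
  fixes X :: "'a::metric_space set" and f :: "'a \<Rightarrow> 'a"
  assumes compact_X: "compact X"
    and X_nonempty: "X \<noteq> {}"
    and continuous_f: "continuous_on X f"
    and f_into: "f ` X \<subseteq> X"
begin

abbreviation Y where "Y \<equiv> essential_points X f"

section \<open>Invariant measures as limits of orbit frequencies\<close>

lemma funpow_in: "x \<in> X \<Longrightarrow> (f ^^ i) x \<in> X"
  using f_into by (induction i) auto

lemma continuous_on_funpow: "continuous_on X (f ^^ i)"
proof (induction i)
  case (Suc i)
  have "(f ^^ i) ` X \<subseteq> X"
    using funpow_in by auto
  then have "continuous_on X (f \<circ> (f ^^ i))"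
    by (intro continuous_on_compose Suc.IH continuous_on_subset[OF continuous_f])
  then show ?case by simp
qed auto

text \<open>A Krylov-Bogolyubov argument: along one filter the visit frequencies of all sets
  converge, the limit is an invariant content, and its regularization is an invariant Borel measure
  that is no smaller on \<open>C\<close>. The starting points may vary with \<open>k\<close>;
  \<open>k < n k\<close> makes the lengths tend to infinity.\<close>

lemma invariant_measure_charging:
  assumes C: "compact C" "C \<subseteq> X"
    and x: "\<And>k. x k \<in> X"
    and n: "\<And>k. k < n k"
    and freq: "\<And>k. \<delta> * real (n k) \<le> (\<Sum>i<n k. indicat_real C ((f ^^ i) (x k)))"
  obtains \<mu> where "\<mu> \<in> invariant_measures X f" "ennreal \<delta> \<le> emeasure \<mu> C"
proof -
  define u where "u k A = (\<Sum>i<n k. indicat_real A ((f ^^ i) (x k))) / real (n k)" for k A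
  have n_pos: "0 < n k" for k
    using n[of k] by auto
  have "u k A \<in> {0..1}" for k A
  proof -
    have "(\<Sum>i<n k. indicat_real A ((f ^^ i) (x k))) \<le> (\<Sum>i<n k. 1)"
      by (intro sum_mono) (auto simp: indicator_def)
    then show ?thesis
      using n_pos[of k] by (auto simp: u_def intro!: sum_nonneg divide_nonneg_nonneg)
  qed
  then obtain H m where H: "H \<noteq> bot" "H \<le> sequentially"
      and m: "\<And>A. ((\<lambda>k. u k A) \<longlongrightarrow> m A) H"
    using tendsto_along_subfilter[of u] by metis
  have nonneg: "0 \<le> m A" for A
  proof (rule tendsto_lowerbound[OF m _ H(1)])
    show "\<forall>\<^sub>F k in H. 0 \<le> u k A"
      by (auto simp: u_def intro!: always_eventually sum_nonneg divide_nonneg_nonneg)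
  qed
  have empty: "m {} = 0"
    using m[of "{}"] tendsto_unique[OF H(1), of "\<lambda>k. u k {}" "m {}" 0] by (simp add: u_def)
  have space: "m X = 1"
  proof -
    have "u k X = 1" for k
      using n_pos[of k] x[of k] by (simp add: u_def funpow_in)
    then show ?thesis
      using m[of X] tendsto_unique[OF H(1), of "\<lambda>k. u k X" "m X" 1] by simp
  qed
  have Un: "m (A \<union> B) = m A + m B" if "A \<inter> B = {}" for A B
  proof -
    have "u k (A \<union> B) = u k A + u k B" for k
      unfolding u_def add_divide_distrib[symmetric] sum.distrib[symmetric]
      using that by (auto simp: indicator_def intro!: arg_cong2[where f="(/)"] sum.cong)
    then show ?thesis
      using tendsto_unique[OF H(1) m[of "A \<union> B"], of "m A + m B"] tendsto_add[OF m[of A] m[of B]]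
      by simp
  qed
  \<comment> \<open>the orbit sums over \<open>f -` A\<close> and \<open>A\<close> telescope to two boundary terms\<close>
  have inv: "m (f -` A \<inter> X) = m A" for A
  proof -
    have diff: "u k (f -` A \<inter> X) - u k A =
        (indicat_real A ((f ^^ n k) (x k)) - indicat_real A (x k)) / real (n k)" for k
    proof -
      have "indicat_real (f -` A \<inter> X) ((f ^^ i) (x k)) = indicat_real A ((f ^^ Suc i) (x k))" for i
        using funpow_in[OF x[of k], of i] by (auto simp: indicator_def)
      then have "u k (f -` A \<inter> X) - u k A =
          (\<Sum>i<n k. indicat_real A ((f ^^ Suc i) (x k)) - indicat_real A ((f ^^ i) (x k))) / real (n k)"
        by (simp add: u_def diff_divide_distrib sum_subtractf)
      also have "\<dots> = (indicat_real A ((f ^^ n k) (x k)) - indicat_real A (x k)) / real (n k)"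
        by (subst sum_lessThan_telescope) simp
      finally show ?thesis .
    qed
    have "(\<lambda>k. u k (f -` A \<inter> X) - u k A) \<longlonglongrightarrow> 0"
    proof (rule Lim_null_comparison)
      have "norm (u k (f -` A \<inter> X) - u k A) \<le> inverse (real (Suc k))" for k
      proof -
        have "\<bar>indicat_real A ((f ^^ n k) (x k)) - indicat_real A (x k)\<bar> \<le> 1"
          by (auto simp: indicator_def)
        then have "norm (u k (f -` A \<inter> X) - u k A) \<le> 1 / real (n k)"
          unfolding diff by (auto simp: abs_divide intro!: divide_right_mono)
        also have "\<dots> \<le> 1 / real (Suc k)"
          using n[of k] by (intro divide_left_mono) auto
        finally show ?thesis by (simp add: divide_inverse)
      qed
      then show "\<forall>\<^sub>F k in sequentially. norm (u k (f -` A \<inter> X) - u k A) \<le> inverse (real (Suc k))"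
        by simp
    qed (rule LIMSEQ_inverse_real_of_nat)
    then have "((\<lambda>k. u k (f -` A \<inter> X) - u k A) \<longlongrightarrow> 0) H"
      by (rule tendsto_mono[OF H(2)])
    moreover have "((\<lambda>k. u k (f -` A \<inter> X) - u k A) \<longlongrightarrow> m (f -` A \<inter> X) - m A) H"
      by (intro tendsto_diff m)
    ultimately show ?thesis
      using tendsto_unique[OF H(1)] by fastforce
  qed
  have ge: "\<delta> \<le> m C"
  proof (rule tendsto_lowerbound[OF m _ H(1)])
    show "\<forall>\<^sub>F k in H. \<delta> \<le> u k C"
      using freq n_pos by (auto simp: u_def field_simps intro!: always_eventually)
  qed
  interpret compact_content X "\<lambda>A. ennreal (m A)"
    by unfold_locales
      (simp_all add: compact_X empty space Un nonneg ennreal_plus)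
  obtain \<mu> where "\<mu> \<in> invariant_measures X f"
      "\<And>C. compact C \<Longrightarrow> C \<subseteq> X \<Longrightarrow> ennreal (m C) \<le> emeasure \<mu> C"
    by (rule invariant_measure_dominating_content[OF continuous_f f_into]) (auto simp: inv)
  with C ge show thesis
    by (intro that[of \<mu>]) (auto intro: order_trans[OF ennreal_leI])
qed

text \<open>Every point of \<open>C\<close> has a neighbourhood that is null for the given measure,
  and finitely many of them cover \<open>C\<close>.\<close>

lemma essential_null_compact:
  assumes C: "compact C" "C \<subseteq> X" "C \<inter> Y = {}" and \<mu>: "\<mu> \<in> invariant_measures X f"
  shows "emeasure \<mu> C = 0"
proof -
  have sets: "sets \<mu> = sets (restrict_space borel X)" and "prob_space \<mu>"
    using \<mu> by (auto simp: invariant_measures_def)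
  interpret prob_space \<mu> by fact
  have "\<exists>T. open T \<and> x \<in> T \<and> measure \<mu> (X \<inter> T) = 0" if "x \<in> C" for x
  proof -
    have "x \<in> X" "x \<notin> Y" using that C by auto
    then obtain V where V: "openin (top_of_set X) V" "x \<in> V"
        "\<not> measure \<mu> V > 0"
      using \<mu> unfolding essential_points_def by blast
    then show ?thesis
      by (auto simp: openin_open zero_less_measure_iff)
  qed
  then obtain T where T: "\<And>x. x \<in> C \<Longrightarrow> open (T x) \<and> x \<in> T x \<and> measure \<mu> (X \<inter> T x) = 0"
    by metis
  obtain D where D: "D \<subseteq> C" "finite D" "C \<subseteq> (\<Union>x\<in>D. T x)"
    by (rule compactE_image[OF C(1), of C T]) (use T in auto)
  have T_sets: "X \<inter> T x \<in> sets \<mu>" if "x \<in> D" for x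
    using T[of x] that D by (auto simp: sets sets_restrict_space intro!: image_eqI[of _ _ "T x"])
  have "(\<Union>x\<in>D. X \<inter> T x) \<in> null_sets \<mu>"
    using T D T_sets
    by (intro null_sets_UN' countable_finite) (auto simp: null_sets_def emeasure_eq_measure)
  moreover have "C \<subseteq> (\<Union>x\<in>D. X \<inter> T x)"
    using C D by auto
  ultimately show ?thesis
    by (meson emeasure_eq_0 null_setsD1 null_setsD2)
qed

text \<open>Otherwise \<open>X\<close> would be a compact set of inessential points, hence null,
  although the orbit of any point produces an invariant measure giving it full mass.\<close>

lemma essential_nonempty: "Y \<noteq> {}"
proof
  assume empty: "Y = {}"
  obtain x where "x \<in> X"
    using X_nonempty by auto
  then obtain \<mu> where \<mu>: "\<mu> \<in> invariant_measures X f" "ennreal 1 \<le> emeasure \<mu> X"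
    using invariant_measure_charging[of X "\<lambda>_. x" Suc 1] compact_X by (auto simp: funpow_in)
  then show False
    using essential_null_compact[OF compact_X _ _ \<mu>(1)] empty by auto
qed

text \<open>The inessential points are cut out of \<open>X\<close> by the union of all open sets
  that every invariant measure ignores.\<close>

lemma compact_essential: "compact Y"
proof -
  define \<T> where "\<T> = {T. open T \<and> (\<forall>\<mu>\<in>invariant_measures X f. \<not> measure \<mu> (X \<inter> T) > 0)}"
  have "Y = X - \<Union>\<T>"
    unfolding essential_points_def \<T>_def openin_open by blast
  moreover have "open (\<Union>\<T>)"
    by (auto simp: \<T>_def)
  ultimately show ?thesis
    using compact_X by (auto intro: compact_diff)
qed

text \<open>If no \<open>N\<close> worked, there would be arbitrarily long orbit segments, with
  varying starting points, that visit \<open>C\<close> with frequency above \<open>\<delta>\<close>;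
  their limit measure would charge \<open>C\<close>.\<close>

lemma inessential_visits:
  assumes C: "compact C" "C \<subseteq> X" "C \<inter> Y = {}" and \<delta>: "0 < \<delta>"
  obtains N where
    "\<And>n x. N \<le> n \<Longrightarrow> x \<in> X \<Longrightarrow> (\<Sum>i<n. indicat_real C ((f ^^ i) x)) \<le> \<delta> * real n"
proof (rule ccontr)
  assume "\<not> thesis"
  then have "\<forall>k. \<exists>n x. k < n \<and> x \<in> X \<and> \<delta> * real n < (\<Sum>i<n. indicat_real C ((f ^^ i) x))"
    using that[of "Suc _"] by (metis Suc_le_eq not_le)
  then obtain n x where nx: "\<And>k. k < n k" "\<And>k. x k \<in> X"
      "\<And>k. \<delta> * real (n k) < (\<Sum>i<n k. indicat_real C ((f ^^ i) (x k)))"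
    by metis
  obtain \<mu> where "\<mu> \<in> invariant_measures X f" "ennreal \<delta> \<le> emeasure \<mu> C"
    by (rule invariant_measure_charging[OF C(1,2) nx(2,1) less_imp_le[OF nx(3)]])
  with essential_null_compact[OF C] \<delta> show False
    by auto
qed

end


section \<open>Roots and limits in the extended nonnegative reals\<close>

lemma root_ennreal_le_iff:
  assumes "0 < n" "0 \<le> t"
  shows "root_ennreal n s \<le> ennreal t \<longleftrightarrow> s \<le> ennreal (t ^ n)"
proof (cases s)
  case (real r)
  have "root n r \<le> t \<longleftrightarrow> r \<le> t ^ n"
    using assms real(1) real_root_le_iff[of n r "t ^ n"] by (simp add: real_root_power_cancel)
  then show ?thesis
    using assms real by (simp add: root_ennreal_def)
qed (auto simp: root_ennreal_def top_unique)

lemma root_ennreal_mono: "0 < n \<Longrightarrow> s \<le> t \<Longrightarrow> root_ennreal n s \<le> root_ennreal n t"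
  by (cases s; cases t) (auto simp: root_ennreal_def top_unique)

lemma root_ennreal_power_mult:
  assumes "0 < n" "0 < c"
  shows "root_ennreal n (ennreal (c ^ n) * s) = ennreal c * root_ennreal n s"
  using assms
  by (cases s) (auto simp: root_ennreal_def ennreal_mult[symmetric] real_root_mult real_root_power_cancel
      ennreal_mult_eq_top_iff)

lemma tendsto_exp_minus_mult_ennreal:
  "((\<lambda>\<kappa>. ennreal (exp (- \<kappa>)) * a) \<longlongrightarrow> a) (at_right 0)"
proof -
  have "((\<lambda>\<kappa>. ennreal (exp (- \<kappa>)) * a) \<longlongrightarrow> ennreal (exp (- 0)) * a) (at_right 0)"
    by (intro tendsto_mult_ennreal tendsto_ennrealI tendsto_intros) auto
  then show ?thesis by simp
qed

text \<open>The error factor disappears as \<open>\<kappa>\<close> tends to 0. Keeping it on the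
  left as a factor below 1 lets infinite values be treated alike.\<close>

lemma ennreal_le_exp_minus:
  fixes a b :: ennreal
  assumes "\<And>\<kappa>. 0 < \<kappa> \<Longrightarrow> ennreal (exp (- \<kappa>)) * a \<le> b"
  shows "a \<le> b"
proof -
  have "\<forall>\<^sub>F \<kappa> in at_right 0. 0 < (\<kappa>::real)"
    by (simp add: eventually_at_right_less)
  then have "\<forall>\<^sub>F \<kappa> in at_right 0. ennreal (exp (- \<kappa>)) * a \<le> b"
    by eventually_elim (rule assms)
  then show ?thesis
    by (rule tendsto_upperbound[OF tendsto_exp_minus_mult_ennreal _ trivial_limit_at_right_real])
qed

text \<open>Since \<open>m\<close> is free at a fixed scale, \<open>upper\<close> yields
  \<open>G \<epsilon> \<le> liminf A\<close> for every positive \<open>\<epsilon>\<close>; combined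
  with \<open>lower\<close> this forces \<open>limsup A \<le> liminf A\<close>. So \<open>A\<close>
  converges, and \<open>G\<close> is squeezed to the same value. Later \<open>A\<close> is the
  spectral sum and \<open>G\<close> the growth rate of spanning sets.\<close>

lemma limsup_squeeze:
  fixes A :: "nat \<Rightarrow> ennreal" and G :: "real \<Rightarrow> ennreal"
  assumes lower: "\<And>\<kappa>. 0 < \<kappa> \<Longrightarrow>
      \<forall>\<^sub>F \<epsilon> in at_right 0. ennreal (exp (- \<kappa>)) * limsup A \<le> G \<epsilon>"
    and upper: "\<And>\<epsilon> \<kappa>. 0 < \<epsilon> \<Longrightarrow> 0 < \<kappa> \<Longrightarrow>
      \<forall>\<^sub>F m in sequentially. ennreal (exp (- \<kappa>)) * G \<epsilon> \<le> A m"
  shows "A \<longlonglongrightarrow> limsup A" and "(G \<longlongrightarrow> limsup A) (at_right 0)"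
proof -
  have G_le: "G \<epsilon> \<le> liminf A" if "0 < \<epsilon>" for \<epsilon>
  proof (rule ennreal_le_exp_minus)
    fix \<kappa> :: real assume "0 < \<kappa>"
    then show "ennreal (exp (- \<kappa>)) * G \<epsilon> \<le> liminf A"
      using upper[OF that] by (intro Liminf_bounded)
  qed
  have ev_pos: "\<forall>\<^sub>F \<epsilon> in at_right (0::real). 0 < \<epsilon>"
    by (simp add: eventually_at_right_less)
  have le: "limsup A \<le> liminf A"
  proof (rule ennreal_le_exp_minus)
    fix \<kappa> :: real assume "0 < \<kappa>"
    have "\<forall>\<^sub>F \<epsilon> in at_right (0::real). ennreal (exp (- \<kappa>)) * limsup A \<le> liminf A"
      using lower[OF \<open>0 < \<kappa>\<close>] ev_pos by eventually_elim (auto intro: order_trans G_le)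
    then show "ennreal (exp (- \<kappa>)) * limsup A \<le> liminf A"
      by simp
  qed
  then have eq: "liminf A = limsup A"
    by (intro antisym Liminf_le_Limsup) auto
  then show "A \<longlonglongrightarrow> limsup A"
    by (intro Liminf_eq_Limsup) auto
  show "(G \<longlongrightarrow> limsup A) (at_right 0)"
  proof (rule order_tendstoI)
    fix a assume "a < limsup A"
    then have "\<forall>\<^sub>F \<kappa> in at_right 0. a < ennreal (exp (- \<kappa>)) * limsup A"
      by (rule order_tendstoD(1)[OF tendsto_exp_minus_mult_ennreal])
    then have "\<forall>\<^sub>F \<kappa> in at_right 0. 0 < \<kappa> \<and> a < ennreal (exp (- \<kappa>)) * limsup A"
      using ev_pos by eventually_elim simp
    then obtain \<kappa> where "0 < \<kappa>" "a < ennreal (exp (- \<kappa>)) * limsup A"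
      using eventually_happens'[OF trivial_limit_at_right_real] by blast
    then show "\<forall>\<^sub>F \<epsilon> in at_right 0. a < G \<epsilon>"
      using lower[of \<kappa>] by (auto elim!: eventually_mono intro: less_le_trans)
  next
    fix a assume a: "limsup A < a"
    show "\<forall>\<^sub>F \<epsilon> in at_right 0. G \<epsilon> < a"
      using ev_pos by eventually_elim (use G_le a eq in \<open>auto intro: le_less_trans\<close>)
  qed
qed

lemma ecard_finite: "finite S \<Longrightarrow> ecard S = ennreal (real (card S))"
  by (simp add: ecard_def ennreal_of_nat_eq_real_of_nat)


section \<open>Fibres and lifts on the essential points\<close>

lemma bowen_dist_less_iff:
  assumes "0 < n"
  shows "bowen_dist f n x y < \<epsilon> \<longleftrightarrow> (\<forall>i<n. dist ((f ^^ i) x) ((f ^^ i) y) < \<epsilon>)"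
  unfolding bowen_dist_def using assms by (subst Max_less_iff) auto

lemma compact_finite_net:
  fixes S :: "'a::metric_space set"
  assumes "compact S" "0 < \<epsilon>"
  obtains F where "finite F" "F \<subseteq> S" "\<And>x. x \<in> S \<Longrightarrow> \<exists>y\<in>F. dist x y < \<epsilon>"
proof -
  obtain F where "F \<subseteq> S" "finite F" "S \<subseteq> (\<Union>y\<in>F. ball y \<epsilon>)"
    by (rule compactE_image[OF assms(1), of S "\<lambda>y. ball y \<epsilon>"]) (use assms(2) in auto)
  then show thesis
    by (intro that[of F]) (auto simp: dist_commute subset_eq)
qed

text \<open>Sending each point to a net point within \<open>r / 2\<close> is injective on
  \<open>S\<close>, since two points sharing a net point are \<open>r\<close>-close.\<close>

lemma finite_if_separated:
  fixes S :: "'a::metric_space set"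
  assumes "compact X" "S \<subseteq> X" "0 < r"
    and sep: "\<And>x y. x \<in> S \<Longrightarrow> y \<in> S \<Longrightarrow> dist x y \<le> r \<Longrightarrow> x = y"
  shows "finite S"
proof -
  obtain F where F: "finite F" "F \<subseteq> X" "\<And>x. x \<in> X \<Longrightarrow> \<exists>y\<in>F. dist x y < r / 2"
    using compact_finite_net[OF assms(1), of "r / 2"] assms(3) by auto
  then obtain g where g: "\<And>x. x \<in> X \<Longrightarrow> g x \<in> F \<and> dist x (g x) < r / 2"
    by metis
  have "inj_on g S"
  proof (rule inj_onI)
    fix x y assume xy: "x \<in> S" "y \<in> S" "g x = g y"
    then have "dist x (g x) < r / 2" "dist y (g y) < r / 2"
      using g assms(2) by blast+
    then show "x = y"
      using xy sep[of x y] dist_triangle2[of x y "g x"] by simp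
  qed
  moreover have "g ` S \<subseteq> F"
    using g assms(2) by auto
  ultimately show ?thesis
    using F(1) inj_on_finite by blast
qed

locale expanding_system = compact_system +
  assumes local_homeo: "local_homeomorphism_on Y Y f"
    and non_contracting: "non_contracting_on Y f"
begin

abbreviation preimage where "preimage \<equiv> essential_preimage X f"

section \<open>Fibres of the restriction to the essential points\<close>

lemma essential_subset: "Y \<subseteq> X"
  by (auto simp: essential_points_def)

lemma preimage_eq: "preimage n x = {y\<in>Y. (f ^^ n) y = x}"
  using essential_subset by (auto simp: essential_preimage_def)

lemma f_essential: "x \<in> Y \<Longrightarrow> f x \<in> Y"
  using local_homeo unfolding local_homeomorphism_on_def
  by (meson image_eqI in_mono openin_imp_subset)

lemma funpow_essential: "x \<in> Y \<Longrightarrow> (f ^^ i) x \<in> Y"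
  by (induction i) (auto intro: f_essential)

lemma non_contractingE:
  obtains r where "0 < r"
    "\<And>x y. x \<in> Y \<Longrightarrow> y \<in> Y \<Longrightarrow> dist x y \<le> r \<Longrightarrow> dist x y \<le> dist (f x) (f y)"
  using non_contracting unfolding non_contracting_on_def by auto

text \<open>Non-contraction applies at each of the first \<open>n\<close> steps while the orbits are
  still \<open>r\<close>-close. Consequently distinct points of one fibre of \<open>f ^^ n\<close>
  must be more than \<open>r\<close> apart at some time before \<open>n\<close>.\<close>

lemma dist_le_dist_funpow:
  assumes r: "\<And>x y. x \<in> Y \<Longrightarrow> y \<in> Y \<Longrightarrow> dist x y \<le> r \<Longrightarrow> dist x y \<le> dist (f x) (f y)"
    and "x \<in> Y" "y \<in> Y" "\<And>i. i < n \<Longrightarrow> dist ((f ^^ i) x) ((f ^^ i) y) \<le> r"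
  shows "dist x y \<le> dist ((f ^^ n) x) ((f ^^ n) y)"
  using assms(4)
proof (induction n)
  case (Suc n)
  have "dist x y \<le> dist ((f ^^ n) x) ((f ^^ n) y)"
    using Suc by auto
  also have "\<dots> \<le> dist (f ((f ^^ n) x)) (f ((f ^^ n) y))"
    using assms(2,3) Suc.prems[of n] by (intro r funpow_essential) auto
  finally show ?case by simp
qed auto

text \<open>Two \<open>r\<close>-close essential points with the same image coincide, so one-step
  fibres are separated and hence finite; longer fibres are finite unions of these.\<close>

lemma finite_preimage: "finite (preimage n x)"
proof (induction n)
  case 0
  show ?case
    by (rule finite_subset[of _ "{x}"]) (auto simp: preimage_eq)
next
  case (Suc n)
  obtain r where r: "0 < r"
      "\<And>x y. x \<in> Y \<Longrightarrow> y \<in> Y \<Longrightarrow> dist x y \<le> r \<Longrightarrow> dist x y \<le> dist (f x) (f y)"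
    using non_contractingE by blast
  have "finite {y\<in>Y. f y = z}" for z
  proof (rule finite_if_separated[OF compact_X _ r(1)])
    fix y y' assume "y \<in> {y\<in>Y. f y = z}" "y' \<in> {y\<in>Y. f y = z}" "dist y y' \<le> r"
    then show "y = y'"
      using r(2)[of y y'] by auto
  qed (use essential_subset in auto)
  moreover have "preimage (Suc n) x \<subseteq> (\<Union>z\<in>preimage n x. {y\<in>Y. f y = z})"
    by (auto simp: preimage_eq f_essential funpow_swap1)
  ultimately show ?case
    using Suc.IH finite_subset by blast
qed

text \<open>The image of a small piece around \<open>p\<close> is open, so a point \<open>v\<close>
  close to \<open>f u\<close> has a preimage near \<open>u\<close>. The bound is only the scale
  \<open>r\<close>; \<open>uniform_lift\<close> sharpens it.\<close>

lemma local_lift: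
  assumes p: "p \<in> Y" and r: "0 < r"
  obtains e where "0 < e" "\<And>u v. u \<in> Y \<Longrightarrow> v \<in> Y \<Longrightarrow> dist u p < e \<Longrightarrow> dist (f u) v < e \<Longrightarrow>
    \<exists>u'\<in>Y. f u' = v \<and> dist u u' \<le> r"
proof -
  obtain U g where U: "openin (top_of_set Y) U" "p \<in> U" "openin (top_of_set Y) (f ` U)"
      "homeomorphism U (f ` U) f g"
    using local_homeo p unfolding local_homeomorphism_on_def by blast
  \<comment> \<open>Radius \<open>r / 2\<close> keeps any two points of the piece within
    \<open>r\<close> of each other, the range of non-contraction.\<close>
  define W where "W = U \<inter> ball p (r / 2)"
  have "openin (top_of_set U) W"
    unfolding W_def by (simp add: openin_open_Int)
  then have "openin (top_of_set (f ` U)) (f ` W)"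
    by (rule homeomorphism_imp_open_map[OF U(4)])
  then have "openin (top_of_set Y) (f ` W)"
    using U(3) by (rule openin_trans)
  moreover have "p \<in> W"
    using U r by (auto simp: W_def)
  ultimately obtain e1 where e1: "0 < e1" "ball (f p) e1 \<inter> Y \<subseteq> f ` W"
    unfolding openin_contains_ball by blast
  have "continuous_on Y f"
    by (rule continuous_on_subset[OF continuous_f essential_subset])
  then obtain d where d: "0 < d" "\<And>u. u \<in> Y \<Longrightarrow> dist u p < d \<Longrightarrow> dist (f u) (f p) < e1 / 2"
    using p e1(1) unfolding continuous_on_iff by (meson half_gt_zero)
  show thesis
  proof (rule that[of "min (r / 2) (min d (e1 / 2))"])
    fix u v assume uv: "u \<in> Y" "v \<in> Y" "dist u p < min (r / 2) (min d (e1 / 2))"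
      "dist (f u) v < min (r / 2) (min d (e1 / 2))"
    have "dist (f p) v < e1"
      using d(2)[of u] uv dist_triangle3[of "f p" v "f u"] by auto
    then obtain u' where u': "u' \<in> W" "v = f u'"
      using e1(2) uv(2) by auto
    then have "dist p u' < r / 2" "u' \<in> Y"
      using openin_imp_subset[OF U(1)] by (auto simp: W_def)
    then show "\<exists>u'\<in>Y. f u' = v \<and> dist u u' \<le> r"
      using u' uv(3) dist_triangle[of u u' p] by auto
  qed (use r d e1 in auto)
qed

text \<open>Compactness makes the local radius uniform. Non-contraction, applied to the
  \<open>r\<close>-close pair \<open>u\<close>, \<open>u'\<close>, then turns the crude bound
  \<open>r\<close> into the distance of the images.\<close>

lemma uniform_lift:
  obtains \<eta> where "0 < \<eta>" "\<And>u v. u \<in> Y \<Longrightarrow> v \<in> Y \<Longrightarrow> dist (f u) v < \<eta> \<Longrightarrow>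
    \<exists>u'\<in>Y. f u' = v \<and> dist u u' \<le> dist (f u) v"
proof -
  obtain r where r: "0 < r"
      "\<And>x y. x \<in> Y \<Longrightarrow> y \<in> Y \<Longrightarrow> dist x y \<le> r \<Longrightarrow> dist x y \<le> dist (f x) (f y)"
    using non_contractingE by blast
  have "\<exists>e>0. \<forall>u\<in>Y. \<forall>v\<in>Y. dist u p < e \<longrightarrow> dist (f u) v < e \<longrightarrow>
    (\<exists>u'\<in>Y. f u' = v \<and> dist u u' \<le> r)" if "p \<in> Y" for p
    using local_lift[OF that r(1)] by metis
  then obtain e where e: "\<And>p. p \<in> Y \<Longrightarrow> 0 < e p"
      "\<And>p u v. p \<in> Y \<Longrightarrow> u \<in> Y \<Longrightarrow> v \<in> Y \<Longrightarrow> dist u p < e p \<Longrightarrow> dist (f u) v < e p \<Longrightarrow>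
        \<exists>u'\<in>Y. f u' = v \<and> dist u u' \<le> r"
    by metis
  obtain D where D: "D \<subseteq> Y" "finite D" "Y \<subseteq> (\<Union>p\<in>D. ball p (e p))"
    by (rule compactE_image[OF compact_essential, of Y "\<lambda>p. ball p (e p)"]) (use e in auto)
  have "D \<noteq> {}"
    using D(3) essential_nonempty by auto
  define \<eta> where "\<eta> = Min (e ` D)"
  show thesis
  proof
    show "0 < \<eta>"
      using D \<open>D \<noteq> {}\<close> e(1) by (auto simp: \<eta>_def)
    fix u v assume uv: "u \<in> Y" "v \<in> Y" "dist (f u) v < \<eta>"
    then obtain p where p: "p \<in> D" "dist u p < e p"
      using D(3) by (auto simp: dist_commute)
    then have "\<eta> \<le> e p"
      using D(2) by (simp add: \<eta>_def)
    then obtain u' where "u' \<in> Y" "f u' = v" "dist u u' \<le> r"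
      using e(2)[of p u v] uv p D(1) by auto
    then show "\<exists>u'\<in>Y. f u' = v \<and> dist u u' \<le> dist (f u) v"
      using r(2)[of u u'] uv by auto
  qed
qed

text \<open>The lift goes backwards: first through \<open>f ^^ n\<close> along the orbit of
  \<open>f u\<close>, then one step further. No step enlarges the distance, so one
  \<open>\<epsilon>\<close> serves for all \<open>n\<close>.\<close>

lemma funpow_lift:
  assumes \<eta>: "\<And>u v. u \<in> Y \<Longrightarrow> v \<in> Y \<Longrightarrow> dist (f u) v < \<eta> \<Longrightarrow>
      \<exists>u'\<in>Y. f u' = v \<and> dist u u' \<le> dist (f u) v"
    and "\<epsilon> \<le> \<eta>" and "u \<in> Y" "v \<in> Y" "dist ((f ^^ n) u) v < \<epsilon>"
  shows "\<exists>u'\<in>Y. (f ^^ n) u' = v \<and> (\<forall>i\<le>n. dist ((f ^^ i) u) ((f ^^ i) u') < \<epsilon>)"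
  using assms(3,5)
proof (induction n arbitrary: u)
  case 0
  then show ?case
    using assms(4) by auto
next
  case (Suc n)
  then obtain w where w: "w \<in> Y" "(f ^^ n) w = v"
      "\<And>i. i \<le> n \<Longrightarrow> dist ((f ^^ i) (f u)) ((f ^^ i) w) < \<epsilon>"
    using Suc.IH[of "f u"] f_essential[of u] by (auto simp: funpow_swap1)
  have "dist (f u) w < \<epsilon>"
    using w(3)[of 0] by simp
  then obtain u' where u': "u' \<in> Y" "f u' = w" "dist u u' < \<epsilon>"
    using \<eta>[of u w] Suc.prems w(1) \<open>\<epsilon> \<le> \<eta>\<close> by auto
  have "dist ((f ^^ i) u) ((f ^^ i) u') < \<epsilon>" if "i \<le> Suc n" for i
    using that u' w(3) by (cases i) (auto simp: funpow_swap1)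
  moreover have "(f ^^ Suc n) u' = v"
    using u' w(2) by (simp add: funpow_swap1)
  ultimately show ?case
    using u'(1) by blast
qed

text \<open>The endpoint \<open>(f ^^ n) x\<close> is near a net point, which lifts back along the
  orbit of \<open>x\<close> to a point shadowing it. The net is fixed before \<open>n\<close>; both
  the forward entropy and the upper bound for the pressure rely on this.\<close>

lemma preimages_of_net:
  assumes "0 < \<epsilon>"
  obtains F where "finite F" "F \<subseteq> Y"
    "\<And>n x. x \<in> Y \<Longrightarrow> \<exists>y\<in>(\<Union>z\<in>F. preimage n z). \<forall>i<n. dist ((f ^^ i) x) ((f ^^ i) y) < \<epsilon>"
proof -
  obtain \<eta> where \<eta>: "0 < \<eta>" "\<And>u v. u \<in> Y \<Longrightarrow> v \<in> Y \<Longrightarrow> dist (f u) v < \<eta> \<Longrightarrow>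
      \<exists>u'\<in>Y. f u' = v \<and> dist u u' \<le> dist (f u) v"
    using uniform_lift by blast
  define \<epsilon>' where "\<epsilon>' = min \<epsilon> \<eta>"
  obtain F where F: "finite F" "F \<subseteq> Y" "\<And>x. x \<in> Y \<Longrightarrow> \<exists>z\<in>F. dist x z < \<epsilon>'"
    using compact_finite_net[OF compact_essential, of \<epsilon>'] assms \<eta>(1) by (auto simp: \<epsilon>'_def)
  show thesis
  proof (rule that[OF F(1,2)])
    fix n x assume x: "x \<in> Y"
    obtain z where z: "z \<in> F" "dist ((f ^^ n) x) z < \<epsilon>'"
      using F(3) funpow_essential[OF x] by blast
    have "\<epsilon>' \<le> \<eta>" "z \<in> Y"
      using z F(2) by (auto simp: \<epsilon>'_def)
    with funpow_lift[OF \<eta>(2) _ x, where \<epsilon>=\<epsilon>' and v=z and n=n] z(2) obtain y where y: "y \<in> Y" "(f ^^ n) y = z"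
        "\<And>i. i \<le> n \<Longrightarrow> dist ((f ^^ i) x) ((f ^^ i) y) < \<epsilon>'"
      by auto
    then show "\<exists>y\<in>(\<Union>z\<in>F. preimage n z). \<forall>i<n. dist ((f ^^ i) x) ((f ^^ i) y) < \<epsilon>"
      using z(1) by (intro bexI[of _ y]) (auto simp: preimage_eq \<epsilon>'_def dest: less_imp_le)
  qed
qed

section \<open>Vanishing of the forward entropy\<close>

lemma eventually_le_exp_power:
  fixes \<kappa> c :: real
  assumes "0 < \<kappa>"
  shows "\<forall>\<^sub>F n in sequentially. c \<le> exp \<kappa> ^ n"
proof -
  obtain N where N: "c < exp \<kappa> ^ N"
    using real_arch_pow[of "exp \<kappa>" c] assms by auto
  have "c \<le> exp \<kappa> ^ n" if "N \<le> n" for n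
    using assms by (intro order.trans[OF less_imp_le[OF N] power_increasing[OF that]]) simp
  then show ?thesis
    unfolding eventually_sequentially by blast
qed

text \<open>The spanning sets from \<open>preimages_of_net\<close> are mapped by
  \<open>f ^^ n\<close> into one fixed finite net, whose cardinality is negligible under
  \<open>n\<close>-th roots. Conversely spanning sets are nonempty, so every count is at least
  1.\<close>

lemma forward_entropy_eq_0: "forward_entropy X f = 0"
proof -
  define G where "G \<epsilon> = limsup (\<lambda>n. INF E\<in>{E. spanning Y f n \<epsilon> E}.
    root_ennreal n (ecard ((f ^^ n) ` E)))" for \<epsilon>
  have "G \<epsilon> = 1" if \<epsilon>: "0 < \<epsilon>" for \<epsilon>
  proof (rule antisym)
    obtain F where F: "finite F" "F \<subseteq> Y"
      "\<And>n x. x \<in> Y \<Longrightarrow> \<exists>y\<in>(\<Union>z\<in>F. preimage n z). \<forall>i<n. dist ((f ^^ i) x) ((f ^^ i) y) < \<epsilon>"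
      using preimages_of_net[OF \<epsilon>] by blast
    show "G \<epsilon> \<le> 1"
    proof (rule ennreal_le_exp_minus)
      fix \<kappa> :: real assume \<kappa>: "0 < \<kappa>"
      have "\<forall>\<^sub>F n in sequentially. (INF E\<in>{E. spanning Y f n \<epsilon> E}.
          root_ennreal n (ecard ((f ^^ n) ` E))) \<le> ennreal (exp \<kappa>)"
        using eventually_le_exp_power[OF \<kappa>, of "card F"] eventually_gt_at_top[of 0]
      proof eventually_elim
        case (elim n)
        define E where "E = (\<Union>z\<in>F. preimage n z)"
        have E: "spanning Y f n \<epsilon> E"
          unfolding spanning_def using F(3)[of _ n] elim(2)
          by (auto simp: bowen_dist_less_iff preimage_eq E_def)
        have "(f ^^ n) ` E \<subseteq> F"
          by (auto simp: E_def preimage_eq)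
        then have "finite ((f ^^ n) ` E)" "card ((f ^^ n) ` E) \<le> card F"
          using F(1) by (auto intro: finite_subset card_mono)
        then have "root_ennreal n (ecard ((f ^^ n) ` E)) \<le> ennreal (exp \<kappa>)"
          using elim by (subst root_ennreal_le_iff) (auto simp: ecard_finite intro!: ennreal_leI)
        then show ?case
          using E by (auto intro: INF_lower2)
      qed
      then have "G \<epsilon> \<le> ennreal (exp \<kappa>)"
        unfolding G_def by (rule Limsup_bounded)
      then have "ennreal (exp (- \<kappa>)) * G \<epsilon> \<le> ennreal (exp (- \<kappa>)) * ennreal (exp \<kappa>)"
        by (rule mult_left_mono) simp
      also have "\<dots> = 1"
        by (simp add: ennreal_mult[symmetric] exp_minus)
      finally show "ennreal (exp (- \<kappa>)) * G \<epsilon> \<le> 1" .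
    qed
    have "\<forall>\<^sub>F n in sequentially. 1 \<le> (INF E\<in>{E. spanning Y f n \<epsilon> E}.
        root_ennreal n (ecard ((f ^^ n) ` E)))"
      using eventually_gt_at_top[of 0]
    proof eventually_elim
      case (elim n)
      show ?case
      proof (rule INF_greatest)
        fix E assume "E \<in> {E. spanning Y f n \<epsilon> E}"
        then obtain y where "y \<in> E"
          using essential_nonempty by (auto simp: spanning_def)
        then have "emeasure (count_space UNIV) {(f ^^ n) y} \<le> ecard ((f ^^ n) ` E)"
          unfolding ecard_def by (intro emeasure_mono) auto
        then have "root_ennreal n 1 \<le> root_ennreal n (ecard ((f ^^ n) ` E))"
          using elim by (intro root_ennreal_mono) auto
        then show "1 \<le> root_ennreal n (ecard ((f ^^ n) ` E))"
          using elim by (simp add: root_ennreal_def)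
      qed
    qed
    then have "1 \<le> liminf (\<lambda>n. INF E\<in>{E. spanning Y f n \<epsilon> E}.
        root_ennreal n (ecard ((f ^^ n) ` E)))"
      by (rule Liminf_bounded)
    also have "\<dots> \<le> G \<epsilon>"
      unfolding G_def by (rule Liminf_le_Limsup) simp
    finally show "1 \<le> G \<epsilon>" .
  qed
  then have "\<forall>\<^sub>F \<epsilon> in at_right 0. G \<epsilon> = 1"
    by (auto simp: eventually_at_filter)
  then have "(G \<longlongrightarrow> 1) (at_right 0)"
    by (rule tendsto_eventually)
  then have "Lim (at_right 0) G = 1"
    by (intro tendsto_Lim) auto
  then show ?thesis
    by (simp add: forward_entropy_def G_def[abs_def] ln_ennreal_def zero_ereal_def)
qed

end


section \<open>Pressure\<close>

lemma sum_le_infsum_ennreal: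
  fixes g :: "'b \<Rightarrow> ennreal"
  assumes "finite S" "S \<subseteq> T"
  shows "sum g S \<le> infsum g T"
proof -
  have "infsum g S \<le> infsum g T"
    by (rule infsum_mono_neutral) (use assms in \<open>auto intro: nonneg_summable_on_complete\<close>)
  then show ?thesis
    using assms(1) by simp
qed

text \<open>The map may identify different pairs, which only lowers the sum. In
  \<open>weighted_covers\<close> this bounds the mass of all itineraries obtained by prepending a
  first piece.\<close>

lemma sum_weighted_products:
  fixes w :: "'b \<Rightarrow> real" and B :: "('c \<times> real) set"
  assumes "finite A" "finite B" "\<And>a. a \<in> A \<Longrightarrow> 0 \<le> w a" "\<And>C v. (C, v) \<in> B \<Longrightarrow> 0 \<le> v"
  shows "(\<Sum>p\<in>(\<lambda>(a, (C, v)). (h a C, w a * v)) ` (A \<times> B). snd p) \<le> (\<Sum>a\<in>A. w a) * (\<Sum>p\<in>B. snd p)"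
proof -
  have "(\<Sum>p\<in>(\<lambda>(a, (C, v)). (h a C, w a * v)) ` (A \<times> B). snd p)
      \<le> (\<Sum>q\<in>A \<times> B. (snd \<circ> (\<lambda>(a, (C, v)). (h a C, w a * v))) q)"
    using assms by (intro sum_image_le) auto
  also have "\<dots> = (\<Sum>(a, p)\<in>A \<times> B. w a * snd p)"
    by (intro sum.cong) auto
  also have "\<dots> = (\<Sum>a\<in>A. w a) * (\<Sum>p\<in>B. snd p)"
    by (simp add: sum_product sum.cartesian_product)
  finally show ?thesis .
qed

definition visits :: "('a \<Rightarrow> 'a) \<Rightarrow> 'a set \<Rightarrow> nat \<Rightarrow> 'a \<Rightarrow> nat" where
  "visits f K n x = card {i. i < n \<and> (f ^^ i) x \<in> K}"

lemma real_visits: "real (visits f K n x) = (\<Sum>i<n. indicat_real K ((f ^^ i) x))"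
proof -
  have "real (visits f K n x) = (\<Sum>i\<in>{i\<in>{..<n}. (f ^^ i) x \<in> K}. 1)"
    by (simp add: visits_def)
  also have "\<dots> = (\<Sum>i<n. if (f ^^ i) x \<in> K then 1 else 0)"
    by (rule sum.inter_filter) simp
  also have "\<dots> = (\<Sum>i<n. indicat_real K ((f ^^ i) x))"
    by (intro sum.cong) (auto simp: indicator_def)
  finally show ?thesis .
qed

lemma visits_add: "visits f K n ((f ^^ m) x) \<le> visits f K (m + n) x"
proof -
  have "card ((+) m ` {i. i < n \<and> (f ^^ i) ((f ^^ m) x) \<in> K}) \<le> visits f K (m + n) x"
    unfolding visits_def
    by (intro card_mono) (auto simp: funpow_add add.commute[of m])
  then show ?thesis
    by (simp add: visits_def card_image)
qed

lemma visits_Suc: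
  assumes "x \<in> K"
  shows "Suc (visits f K n (f x)) \<le> visits f K (Suc n) x"
proof -
  have "card (insert 0 (Suc ` {i. i < n \<and> (f ^^ i) (f x) \<in> K})) \<le> visits f K (Suc n) x"
    unfolding visits_def
    using assms by (intro card_mono) (auto simp: funpow_swap1)
  then show ?thesis
    by (simp add: visits_def card_image)
qed

locale expanding_potential = expanding_system +
  fixes \<phi> :: "'a \<Rightarrow> real"
  assumes continuous_\<phi>: "continuous_on X \<phi>"
begin

definition weight :: "nat \<Rightarrow> 'a \<Rightarrow> real" where
  "weight n y = (\<Prod>i<n. exp (\<phi> ((f ^^ i) y)))"

definition spectral_sum :: "nat \<Rightarrow> ennreal" where
  "spectral_sum n = (SUP x\<in>Y. root_ennreal n (\<Sum>\<^sub>\<infinity>y\<in>preimage n x. ennreal (weight n y)))"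

definition spanning_sum :: "nat \<Rightarrow> real \<Rightarrow> ennreal" where
  "spanning_sum n \<epsilon> = (INF E\<in>{E. spanning X f n \<epsilon> E}.
     root_ennreal n (\<Sum>\<^sub>\<infinity>y\<in>E. ennreal (weight n y)))"

section \<open>Orbit weights and their distortion\<close>

lemma weight_pos: "0 < weight n y"
  by (auto simp: weight_def intro: prod_pos)

lemma weight_nonneg [simp]: "0 \<le> weight n y"
  by (rule less_imp_le[OF weight_pos])

lemma weight_add: "weight (m + n) x = weight m x * weight n ((f ^^ m) x)"
  by (induction n) (auto simp: weight_def funpow_add add.commute[of m])

lemma weight_Suc: "weight (Suc n) x = exp (\<phi> x) * weight n (f x)"
  using weight_add[of 1 n x] by (simp add: weight_def)

lemma uniform_potential:
  assumes "0 < \<kappa>"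
  obtains \<epsilon> where "0 < \<epsilon>" "\<And>x y. x \<in> X \<Longrightarrow> y \<in> X \<Longrightarrow> dist x y < \<epsilon> \<Longrightarrow> \<phi> x \<le> \<phi> y + \<kappa>"
proof -
  have "uniformly_continuous_on X \<phi>"
    by (rule compact_uniformly_continuous[OF continuous_\<phi> compact_X])
  then obtain \<epsilon> where "0 < \<epsilon>" "\<And>x y. x \<in> X \<Longrightarrow> y \<in> X \<Longrightarrow> dist y x < \<epsilon> \<Longrightarrow> dist (\<phi> y) (\<phi> x) < \<kappa>"
    using assms unfolding uniformly_continuous_on_def by meson
  then show thesis
    by (intro that[of \<epsilon>]) (force simp: dist_real_def)+
qed

lemma weight_le:
  assumes "\<And>x y. x \<in> X \<Longrightarrow> y \<in> X \<Longrightarrow> dist x y < \<epsilon> \<Longrightarrow> \<phi> x \<le> \<phi> y + \<kappa>"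
    and "x \<in> X" "y \<in> X" "\<And>i. i < n \<Longrightarrow> dist ((f ^^ i) x) ((f ^^ i) y) < \<epsilon>"
  shows "weight n x \<le> exp \<kappa> ^ n * weight n y"
proof -
  have "weight n x \<le> (\<Prod>i<n. exp \<kappa> * exp (\<phi> ((f ^^ i) y)))"
    unfolding weight_def
    using assms by (intro prod_mono) (auto simp: exp_add[symmetric] funpow_in add.commute)
  also have "\<dots> = exp \<kappa> ^ n * weight n y"
    by (simp add: weight_def prod.distrib)
  finally show ?thesis .
qed

text \<open>Each point \<open>y\<close> of a fibre gets a shadowing point \<open>e y\<close> of the
  spanning set. Two fibre points with the same shadow stay \<open>r\<close>-close for
  \<open>n\<close> steps and have equal \<open>n\<close>-th images, hence coincide. So the fibre
  injects into \<open>E\<close>, with weights distorted by at most \<open>exp \<kappa>\<close> per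
  step.\<close>

lemma spectral_sum_le_spanning_sum:
  assumes "0 < \<kappa>"
  obtains \<epsilon>\<^sub>0 where "0 < \<epsilon>\<^sub>0"
    "\<And>n \<epsilon>. 0 < n \<Longrightarrow> \<epsilon> < \<epsilon>\<^sub>0 \<Longrightarrow> ennreal (exp (- \<kappa>)) * spectral_sum n \<le> spanning_sum n \<epsilon>"
proof -
  obtain r where r: "0 < r"
      "\<And>x y. x \<in> Y \<Longrightarrow> y \<in> Y \<Longrightarrow> dist x y \<le> r \<Longrightarrow> dist x y \<le> dist (f x) (f y)"
    using non_contractingE by blast
  obtain \<epsilon>1 where \<epsilon>1: "0 < \<epsilon>1" "\<And>x y. x \<in> X \<Longrightarrow> y \<in> X \<Longrightarrow> dist x y < \<epsilon>1 \<Longrightarrow> \<phi> x \<le> \<phi> y + \<kappa>"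
    using uniform_potential[OF assms] by blast
  show thesis
  \<comment> \<open>The bound \<open>r / 2\<close> serves the triangle inequality behind
    injectivity, \<open>\<epsilon>1\<close> the comparison of weights.\<close>
  proof (rule that[of "min (r / 2) \<epsilon>1"])
    fix n \<epsilon> assume n: "0 < (n::nat)" and \<epsilon>: "\<epsilon> < min (r / 2) \<epsilon>1"
    have le: "ennreal (exp (- \<kappa>)) * root_ennreal n (\<Sum>\<^sub>\<infinity>y\<in>preimage n x. ennreal (weight n y))
        \<le> root_ennreal n (\<Sum>\<^sub>\<infinity>y\<in>E. ennreal (weight n y))"
      if E: "spanning X f n \<epsilon> E" for E x
    proof -
      have "\<exists>z\<in>E. \<forall>i<n. dist ((f ^^ i) y) ((f ^^ i) z) < \<epsilon>" if "y \<in> preimage n x" for y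
        using E that essential_subset n unfolding spanning_def preimage_eq
        by (auto simp: bowen_dist_less_iff)
      then obtain e where e: "\<And>y. y \<in> preimage n x \<Longrightarrow> e y \<in> E"
          "\<And>y i. y \<in> preimage n x \<Longrightarrow> i < n \<Longrightarrow> dist ((f ^^ i) y) ((f ^^ i) (e y)) < \<epsilon>"
        by metis
      have inj: "inj_on e (preimage n x)"
      proof (rule inj_onI)
        fix y y' assume y: "y \<in> preimage n x" "y' \<in> preimage n x" "e y = e y'"
        have "dist ((f ^^ i) y) ((f ^^ i) y') \<le> r" if "i < n" for i
          using e(2)[OF y(1) that] e(2)[OF y(2) that] y(3) \<epsilon>
            dist_triangle2[of "(f ^^ i) y" "(f ^^ i) y'" "(f ^^ i) (e y)"] by simp
        then have "dist y y' \<le> dist ((f ^^ n) y) ((f ^^ n) y')"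
          using y by (intro dist_le_dist_funpow[OF r(2)]) (auto simp: preimage_eq)
        then show "y = y'"
          using y by (simp add: preimage_eq)
      qed
      have w: "weight n y \<le> exp \<kappa> ^ n * weight n (e y)" if "y \<in> preimage n x" for y
      proof (rule weight_le[OF \<epsilon>1(2)])
        show "y \<in> X" "e y \<in> X"
          using that e(1)[OF that] E essential_subset by (auto simp: preimage_eq spanning_def)
        show "dist ((f ^^ i) y) ((f ^^ i) (e y)) < \<epsilon>1" if "i < n" for i
          using e(2)[OF \<open>y \<in> preimage n x\<close> that] \<epsilon> by simp
      qed
      have "ennreal (exp (- \<kappa>) ^ n) * (\<Sum>\<^sub>\<infinity>y\<in>preimage n x. ennreal (weight n y))
          = (\<Sum>y\<in>preimage n x. ennreal (exp (- \<kappa>) ^ n * weight n y))"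
        by (simp add: finite_preimage sum_distrib_left ennreal_mult del: sum_ennreal)
      also have "\<dots> \<le> (\<Sum>y\<in>preimage n x. ennreal (weight n (e y)))"
      proof (intro sum_mono ennreal_leI)
        fix y assume "y \<in> preimage n x"
        then have "exp (- \<kappa>) ^ n * weight n y \<le> exp (- \<kappa>) ^ n * (exp \<kappa> ^ n * weight n (e y))"
          by (intro mult_left_mono w) auto
        also have "\<dots> = weight n (e y)"
          by (simp add: mult.assoc[symmetric] power_mult_distrib[symmetric] exp_minus)
        finally show "exp (- \<kappa>) ^ n * weight n y \<le> weight n (e y)" .
      qed
      also have "\<dots> = (\<Sum>z\<in>e ` preimage n x. ennreal (weight n z))"
        by (simp add: sum.reindex[OF inj])
      also have "\<dots> \<le> (\<Sum>\<^sub>\<infinity>z\<in>E. ennreal (weight n z))"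
        using e(1) by (intro sum_le_infsum_ennreal) (auto simp: finite_preimage)
      finally have "root_ennreal n (ennreal (exp (- \<kappa>) ^ n) * (\<Sum>\<^sub>\<infinity>y\<in>preimage n x. ennreal (weight n y)))
          \<le> root_ennreal n (\<Sum>\<^sub>\<infinity>z\<in>E. ennreal (weight n z))"
        by (rule root_ennreal_mono[OF n])
      then show ?thesis
        by (simp add: root_ennreal_power_mult[OF n])
    qed
    show "ennreal (exp (- \<kappa>)) * spectral_sum n \<le> spanning_sum n \<epsilon>"
      unfolding spectral_sum_def spanning_sum_def SUP_mult_left_ennreal
      using le by (intro INF_greatest SUP_least) auto
  qed (use r \<epsilon>1 in auto)
qed

text \<open>The sets of the cover correspond to itineraries: blocks of length \<open>m\<close> that follow a point of
  \<open>E\<close>, and single steps that follow a point of \<open>F\<close> while the orbit is in \<open>K\<close> or fewer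
  than \<open>m\<close> steps remain. Single steps are discounted by the factor \<open>z\<close>; this keeps the total
  mass below the geometric bound \<open>\<rho>\<^sup>n\<close> and is paid for by the power of \<open>z\<close> in the lower
  bound for \<open>v\<close>.\<close>

lemma weighted_covers:
  fixes \<rho> \<theta> z R Q :: real
  assumes E: "finite E" "E \<subseteq> X" and F: "finite F" "F \<subseteq> X" and m: "0 < m"
    and cover_E: "\<And>x. x \<in> X - K \<Longrightarrow> \<exists>e\<in>E. \<forall>i<m. dist ((f ^^ i) x) ((f ^^ i) e) < \<epsilon>"
    and cover_F: "\<And>x. x \<in> X \<Longrightarrow> \<exists>y\<in>F. dist x y < \<epsilon>"
    and \<phi>: "\<And>x y. x \<in> X \<Longrightarrow> y \<in> X \<Longrightarrow> dist x y < \<epsilon> \<Longrightarrow> \<phi> x \<le> \<phi> y + \<kappa>"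
    and z: "0 < z" "z \<le> 1" and \<rho>: "0 < \<rho>"
    and sum_E: "(\<Sum>e\<in>E. exp \<kappa> ^ m * weight m e) \<le> (1 - \<theta>) * \<rho> ^ m"
    and sum_F: "(\<Sum>y\<in>F. z * exp (\<phi> y + \<kappa>)) \<le> \<theta> * \<rho>"
    and \<theta>: "0 \<le> \<theta>" "\<theta> \<le> 1"
  shows "\<exists>\<C>. finite \<C> \<and> X \<subseteq> \<Union>(fst ` \<C>) \<and> (\<Sum>p\<in>\<C>. snd p) \<le> \<rho> ^ n \<and>
    (\<forall>(C, v)\<in>\<C>. C \<subseteq> X \<and> 0 \<le> v \<and>
      (\<forall>x\<in>C. \<forall>y\<in>C. \<forall>i<n. dist ((f ^^ i) x) ((f ^^ i) y) < 2 * \<epsilon>) \<and>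
      (\<forall>x\<in>C. weight n x * z ^ (visits f K n x + min n m) \<le> v))"
    (is "\<exists>\<C>. ?good n \<C>")
proof (induction n rule: less_induct)
  case (less n)
  show ?case
  proof (cases n)
    case 0
    have "?good n {(X, 1)}"
      using 0 by (auto simp: weight_def visits_def)
    then show ?thesis by blast
  next
    case (Suc n')
    obtain \<C>' where \<C>': "?good n' \<C>'"
      using less[of n'] Suc by blast
    obtain \<C>'' where \<C>'': "?good (n - m) \<C>''"
      using less[of "n - m"] Suc m by auto
    \<comment> \<open>\<open>\<D>1\<close> prepends a single step to the itineraries of length
      \<open>n'\<close>, \<open>\<D>2\<close> prepends a block to those of length
      \<open>n - m\<close>.\<close>
    define \<D>1 where "\<D>1 = (\<lambda>(y, (C, v)). ({x\<in>X. (n < m \<or> x \<in> K) \<and> dist x y < \<epsilon> \<and> f x \<in> C},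
      (z * exp (\<phi> y + \<kappa>)) * v)) ` (F \<times> \<C>')"
    define \<D>2 where "\<D>2 = (if n < m then {} else
      (\<lambda>(e, (C, v)). ({x\<in>X - K. (\<forall>i<m. dist ((f ^^ i) x) ((f ^^ i) e) < \<epsilon>) \<and> (f ^^ m) x \<in> C},
        (exp \<kappa> ^ m * weight m e) * v)) ` (E \<times> \<C>''))"
    have fin: "finite \<D>1" "finite \<D>2"
      using E F \<C>' \<C>'' by (auto simp: \<D>1_def \<D>2_def)
    have nonneg: "0 \<le> snd p" if "p \<in> \<D>1 \<union> \<D>2" for p
      using that \<C>' \<C>'' z by (fastforce simp: \<D>1_def \<D>2_def split: if_splits)
    \<comment> \<open>The budget \<open>\<rho> ^ n\<close> is divided: the share
      \<open>\<theta>\<close> pays for itineraries beginning with a single step, the rest for those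
      beginning with a block.\<close>
    have sum1: "(\<Sum>p\<in>\<D>1. snd p) \<le> \<theta> * \<rho> ^ n"
    proof -
      have "(\<Sum>p\<in>\<D>1. snd p) \<le> (\<Sum>y\<in>F. z * exp (\<phi> y + \<kappa>)) * (\<Sum>p\<in>\<C>'. snd p)"
        unfolding \<D>1_def using F \<C>' z by (intro sum_weighted_products) auto
      also have "\<dots> \<le> (\<theta> * \<rho>) * \<rho> ^ n'"
        using \<C>' \<theta> \<rho> by (intro mult_mono sum_F sum_nonneg) auto
      finally show ?thesis
        using Suc by simp
    qed
    have sum2: "(\<Sum>p\<in>\<D>2. snd p) \<le> (1 - \<theta>) * \<rho> ^ n"
    proof (cases "n < m")
      case False
      have "(\<Sum>p\<in>\<D>2. snd p) \<le> (\<Sum>e\<in>E. exp \<kappa> ^ m * weight m e) * (\<Sum>p\<in>\<C>''. snd p)"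
        unfolding \<D>2_def using False E \<C>'' by (simp only: if_False, intro sum_weighted_products) auto
      also have "\<dots> \<le> ((1 - \<theta>) * \<rho> ^ m) * \<rho> ^ (n - m)"
        using \<C>'' \<theta> \<rho> by (intro mult_mono sum_E sum_nonneg) auto
      also have "\<dots> = (1 - \<theta>) * \<rho> ^ n"
        using False by (simp add: power_add[symmetric])
      finally show ?thesis .
    qed (use \<rho> \<theta> in \<open>simp add: \<D>2_def\<close>)
    have "(\<Sum>p\<in>\<D>1 \<union> \<D>2. snd p) \<le> (\<Sum>p\<in>\<D>1. snd p) + (\<Sum>p\<in>\<D>2. snd p)"
    proof -
      have "0 \<le> (\<Sum>p\<in>\<D>1 \<inter> \<D>2. snd p)"
        by (rule sum_nonneg) (use nonneg in auto)
      then show ?thesis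
        using sum.union_inter[OF fin, of snd] by linarith
    qed
    with sum1 sum2 have sum: "(\<Sum>p\<in>\<D>1 \<union> \<D>2. snd p) \<le> \<rho> ^ n"
      by (simp add: algebra_simps)
    have cover: "X \<subseteq> \<Union>(fst ` (\<D>1 \<union> \<D>2))"
    proof
      fix x assume x: "x \<in> X"
      show "x \<in> \<Union>(fst ` (\<D>1 \<union> \<D>2))"
      proof (cases "n < m \<or> x \<in> K")
        case True
        obtain y where y: "y \<in> F" "dist x y < \<epsilon>"
          using cover_F[OF x] by blast
        have fx: "f x \<in> X"
          using funpow_in[OF x, of 1] by simp
        obtain p where "p \<in> \<C>'" "f x \<in> fst p"
          using subsetD[OF conjunct1[OF conjunct2[OF \<C>']] fx] by (rule UN_E)
        then obtain C v where "(C, v) \<in> \<C>'" "f x \<in> C"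
          by (cases p) simp
        then have "({x\<in>X. (n < m \<or> x \<in> K) \<and> dist x y < \<epsilon> \<and> f x \<in> C}, (z * exp (\<phi> y + \<kappa>)) * v) \<in> \<D>1"
          unfolding \<D>1_def using y(1) by (intro image_eqI[of _ _ "(y, (C, v))"]) simp_all
        from imageI[OF UnI1[OF this, of \<D>2], of fst]
        have "{x\<in>X. (n < m \<or> x \<in> K) \<and> dist x y < \<epsilon> \<and> f x \<in> C} \<in> fst ` (\<D>1 \<union> \<D>2)"
          by (simp only: fst_conv)
        then show ?thesis
          by (rule UnionI) (use x y \<open>f x \<in> C\<close> True in simp)
      next
        case False
        then obtain e where e: "e \<in> E" "\<forall>i<m. dist ((f ^^ i) x) ((f ^^ i) e) < \<epsilon>"
          using cover_E[of x] x by blast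
        obtain p where "p \<in> \<C>''" "(f ^^ m) x \<in> fst p"
          using subsetD[OF conjunct1[OF conjunct2[OF \<C>'']] funpow_in[OF x, of m]] by (rule UN_E)
        then obtain C v where "(C, v) \<in> \<C>''" "(f ^^ m) x \<in> C"
          by (cases p) simp
        moreover have "\<not> n < m"
          using False by simp
        ultimately have "({x\<in>X - K. (\<forall>i<m. dist ((f ^^ i) x) ((f ^^ i) e) < \<epsilon>) \<and> (f ^^ m) x \<in> C},
            (exp \<kappa> ^ m * weight m e) * v) \<in> \<D>2"
          unfolding \<D>2_def if_not_P[OF \<open>\<not> n < m\<close>] using e(1)
          by (intro image_eqI[of _ _ "(e, (C, v))"]) simp_all
        from imageI[OF UnI2[OF this, of \<D>1], of fst]
        have "{x\<in>X - K. (\<forall>i<m. dist ((f ^^ i) x) ((f ^^ i) e) < \<epsilon>) \<and> (f ^^ m) x \<in> C}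
            \<in> fst ` (\<D>1 \<union> \<D>2)"
          by (simp only: fst_conv)
        then show ?thesis
          by (rule UnionI) (use x e(2) \<open>(f ^^ m) x \<in> C\<close> False in simp)
      qed
    qed
    have elem: "C \<subseteq> X \<and> 0 \<le> v \<and>
        (\<forall>x\<in>C. \<forall>y\<in>C. \<forall>i<n. dist ((f ^^ i) x) ((f ^^ i) y) < 2 * \<epsilon>) \<and>
        (\<forall>x\<in>C. weight n x * z ^ (visits f K n x + min n m) \<le> v)"
      if Cv: "(C, v) \<in> \<D>1 \<union> \<D>2" for C v
    proof (cases "(C, v) \<in> \<D>1")
      case True
      then obtain y C' v' where y: "y \<in> F" "(C', v') \<in> \<C>'" "v = (z * exp (\<phi> y + \<kappa>)) * v'"
          and C: "C = {x\<in>X. (n < m \<or> x \<in> K) \<and> dist x y < \<epsilon> \<and> f x \<in> C'}"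
        unfolding \<D>1_def by auto
      have C': "C' \<subseteq> X" "0 \<le> v'"
          "\<And>x y i. x \<in> C' \<Longrightarrow> y \<in> C' \<Longrightarrow> i < n' \<Longrightarrow> dist ((f ^^ i) x) ((f ^^ i) y) < 2 * \<epsilon>"
          "\<And>x. x \<in> C' \<Longrightarrow> weight n' x * z ^ (visits f K n' x + min n' m) \<le> v'"
        using bspec[OF conjunct2[OF conjunct2[OF conjunct2[OF \<C>']]] y(2)] by simp_all
      have "dist ((f ^^ i) x) ((f ^^ i) x') < 2 * \<epsilon>" if "x \<in> C" "x' \<in> C" "i < n" for x x' i
      proof (cases i)
        case 0
        have "dist x y < \<epsilon>" "dist x' y < \<epsilon>"
          using that C by auto
        then show ?thesis
          using dist_triangle2[of x x' y] 0 by simp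
      next
        case (Suc j)
        then show ?thesis
          using C'(3)[of "f x" "f x'" j] that C \<open>n = Suc n'\<close> by (auto simp: funpow_swap1)
      qed
      moreover have "weight n x * z ^ (visits f K n x + min n m) \<le> v" if x: "x \<in> C" for x
      proof -
        \<comment> \<open>From \<open>x\<close> to \<open>f x\<close> the exponent must fall by at
          least one, to match the discount \<open>z\<close> of the step. For \<open>n < m\<close>
          the term \<open>min n m\<close> falls; otherwise \<open>x\<close> is in \<open>K\<close>
          and a visit is used up.\<close>
        have "1 + (visits f K n' (f x) + min n' m) \<le> visits f K n x + min n m"
        proof (cases "n < m")
          case True
          have "visits f K n' ((f ^^ 1) x) \<le> visits f K (1 + n') x"
            by (rule visits_add)
          then show ?thesis
            using True Suc by simp
        next
          case False
          then have "Suc (visits f K n' (f x)) \<le> visits f K (Suc n') x"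
            using x C by (intro visits_Suc) auto
          then show ?thesis
            using Suc by simp
        qed
        then have "z ^ (visits f K n x + min n m) \<le> z ^ (1 + (visits f K n' (f x) + min n' m))"
          using z by (intro power_decreasing) auto
        then have "weight n x * z ^ (visits f K n x + min n m)
            \<le> weight n x * z ^ (1 + (visits f K n' (f x) + min n' m))"
          by (intro mult_left_mono) auto
        also have "\<dots> = (z * exp (\<phi> x)) * (weight n' (f x) * z ^ (visits f K n' (f x) + min n' m))"
          by (simp add: Suc weight_Suc)
        also have "\<dots> \<le> (z * exp (\<phi> y + \<kappa>)) * v'"
          using x C y F z by (intro mult_mono C'(4)) (auto intro!: \<phi>)
        finally show ?thesis
          using y(3) by simp
      qed
      ultimately show ?thesis
        using C nonneg[OF Cv] by auto
    next
      case False
      then have "(C, v) \<in> \<D>2"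
        using Cv by auto
      then obtain e C' v' where e: "e \<in> E" "(C', v') \<in> \<C>''" "v = (exp \<kappa> ^ m * weight m e) * v'"
          and C: "C = {x\<in>X - K. (\<forall>i<m. dist ((f ^^ i) x) ((f ^^ i) e) < \<epsilon>) \<and> (f ^^ m) x \<in> C'}"
          and nm: "m \<le> n"
        unfolding \<D>2_def by (auto split: if_splits)
      have C': "C' \<subseteq> X" "0 \<le> v'"
          "\<And>x y i. x \<in> C' \<Longrightarrow> y \<in> C' \<Longrightarrow> i < n - m \<Longrightarrow> dist ((f ^^ i) x) ((f ^^ i) y) < 2 * \<epsilon>"
          "\<And>x. x \<in> C' \<Longrightarrow> weight (n - m) x * z ^ (visits f K (n - m) x + min (n - m) m) \<le> v'"
        using bspec[OF conjunct2[OF conjunct2[OF conjunct2[OF \<C>'']]] e(2)] by simp_all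
      have "dist ((f ^^ i) x) ((f ^^ i) x') < 2 * \<epsilon>" if "x \<in> C" "x' \<in> C" "i < n" for x x' i
      proof (cases "i < m")
        case True
        then have "dist ((f ^^ i) x) ((f ^^ i) e) < \<epsilon>" "dist ((f ^^ i) x') ((f ^^ i) e) < \<epsilon>"
          using that C by auto
        then show ?thesis
          using dist_triangle2[of "(f ^^ i) x" "(f ^^ i) x'" "(f ^^ i) e"] by simp
      next
        case False
        have "(f ^^ i) u = (f ^^ (i - m)) ((f ^^ m) u)" for u
          using False funpow_add[of "i - m" m f] by simp
        then show ?thesis
          using C'(3)[of "(f ^^ m) x" "(f ^^ m) x'" "i - m"] that False C by auto
      qed
      moreover have "weight n x * z ^ (visits f K n x + min n m) \<le> v" if x: "x \<in> C" for x
      proof -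
        let ?u = "(f ^^ m) x"
        \<comment> \<open>A block has no discount, so here the exponent merely must not increase
          from \<open>x\<close> to \<open>?u\<close>.\<close>
        have "visits f K (n - m) ?u \<le> visits f K n x"
          using visits_add[of f K "n - m" m x] nm by simp
        then have "z ^ (visits f K n x + min n m) \<le> z ^ (visits f K (n - m) ?u + min (n - m) m)"
          using z by (intro power_decreasing) auto
        then have "weight n x * z ^ (visits f K n x + min n m)
            \<le> weight n x * z ^ (visits f K (n - m) ?u + min (n - m) m)"
          by (intro mult_left_mono) auto
        also have "\<dots> = weight m x * (weight (n - m) ?u * z ^ (visits f K (n - m) ?u + min (n - m) m))"
          using weight_add[of m "n - m" x] nm by simp
        also have "\<dots> \<le> (exp \<kappa> ^ m * weight m e) * v'"
          using x C e E z by (intro mult_mono C'(4) weight_le[OF \<phi>]) auto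
        finally show ?thesis
          using e(3) by simp
      qed
      ultimately show ?thesis
        using C nonneg[OF Cv] by auto
    qed
    have "?good n (\<D>1 \<union> \<D>2)"
    proof (intro conjI ballI)
      fix p assume p: "p \<in> \<D>1 \<union> \<D>2"
      obtain C v where Cv: "p = (C, v)"
        by (rule prod.exhaust)
      show "case p of (C, v) \<Rightarrow> C \<subseteq> X \<and> 0 \<le> v \<and>
          (\<forall>x\<in>C. \<forall>y\<in>C. \<forall>i<n. dist ((f ^^ i) x) ((f ^^ i) y) < 2 * \<epsilon>) \<and>
          (\<forall>x\<in>C. weight n x * z ^ (visits f K n x + min n m) \<le> v)"
        unfolding Cv prod.case by (rule elem[OF p[unfolded Cv]])
    qed (rule finite_UnI[OF fin] cover sum)+
    then show ?thesis by (rule exI)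
  qed
qed

text \<open>One point is picked from each nonempty set of the cover. Small Bowen diameter makes
  these points spanning, and dividing the masses by \<open>c\<close> bounds their total weight by
  \<open>s / c\<close>.\<close>

lemma spanning_sum_le:
  assumes n: "0 < n" and \<C>: "finite \<C>" "X \<subseteq> \<Union>(fst ` \<C>)" "(\<Sum>p\<in>\<C>. snd p) \<le> s"
    and small: "\<And>C v x y i. (C, v) \<in> \<C> \<Longrightarrow> x \<in> C \<Longrightarrow> y \<in> C \<Longrightarrow> i < n \<Longrightarrow>
      dist ((f ^^ i) x) ((f ^^ i) y) < \<epsilon>"
    and heavy: "\<And>C v x. (C, v) \<in> \<C> \<Longrightarrow> x \<in> C \<Longrightarrow> x \<in> X \<and> weight n x * c \<le> v"
    and nonneg: "\<And>C v. (C, v) \<in> \<C> \<Longrightarrow> 0 \<le> v"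
    and c: "0 < c" and t: "0 \<le> t" "s \<le> c * t ^ n"
  shows "spanning_sum n \<epsilon> \<le> ennreal t"
proof -
  define g where "g p = (SOME x. x \<in> fst p)" for p :: "'a set \<times> real"
  define \<C>' where "\<C>' = {p\<in>\<C>. fst p \<noteq> {}}"
  have g: "g p \<in> fst p" if "p \<in> \<C>'" for p
    using that unfolding g_def \<C>'_def by (auto intro: someI_ex)
  have fin: "finite \<C>'"
    using \<C>(1) by (simp add: \<C>'_def)
  have w: "weight n (g p) * c \<le> snd p" "g p \<in> X" if "p \<in> \<C>'" for p
    using heavy[of "fst p" "snd p" "g p"] g[OF that] that by (auto simp: \<C>'_def)
  have "\<exists>y\<in>g ` \<C>'. \<forall>i<n. dist ((f ^^ i) x) ((f ^^ i) y) < \<epsilon>" if x: "x \<in> X" for x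
  proof -
    obtain p where p: "p \<in> \<C>" "x \<in> fst p"
      using subsetD[OF \<C>(2) x] by (rule UN_E)
    then have p': "p \<in> \<C>'"
      by (auto simp: \<C>'_def)
    have "\<forall>i<n. dist ((f ^^ i) x) ((f ^^ i) (g p)) < \<epsilon>"
      using small[of "fst p" "snd p" x "g p"] p g[OF p'] by simp
    then show ?thesis
      using p' by blast
  qed
  then have span: "spanning X f n \<epsilon> (g ` \<C>')"
    using w(2) n by (auto simp: spanning_def bowen_dist_less_iff)
  have "(\<Sum>y\<in>g ` \<C>'. weight n y) \<le> (\<Sum>p\<in>\<C>'. weight n (g p))"
    using fin sum_image_le[of \<C>' "weight n" g] by (simp add: o_def)
  also have "\<dots> \<le> (\<Sum>p\<in>\<C>'. snd p / c)"
    using w(1) c by (intro sum_mono) (simp add: field_simps)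
  also have "\<dots> = (\<Sum>p\<in>\<C>'. snd p) / c"
    by (simp add: sum_divide_distrib)
  also have "\<dots> \<le> (\<Sum>p\<in>\<C>. snd p) / c"
    using \<C>(1) nonneg c by (intro divide_right_mono sum_mono2) (auto simp: \<C>'_def)
  also have "\<dots> \<le> t ^ n"
    using \<C>(3) t(2) c by (simp add: field_simps)
  finally have le: "(\<Sum>y\<in>g ` \<C>'. weight n y) \<le> t ^ n" .
  have "root_ennreal n (\<Sum>\<^sub>\<infinity>y\<in>g ` \<C>'. ennreal (weight n y)) \<le> ennreal t"
    using le fin by (subst root_ennreal_le_iff[OF n t(1)]) (auto intro!: ennreal_leI)
  then show ?thesis
    unfolding spanning_sum_def using span by (intro INF_lower2) auto
qed

section \<open>Upper bound for the pressure by a single spectral sum\<close>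

lemma uniform_orbit_continuity:
  assumes "0 < \<epsilon>"
  obtains \<tau> where "0 < \<tau>" "\<And>x y i. x \<in> X \<Longrightarrow> y \<in> X \<Longrightarrow> dist x y < \<tau> \<Longrightarrow> i < m \<Longrightarrow>
    dist ((f ^^ i) x) ((f ^^ i) y) < \<epsilon>"
proof (induction m arbitrary: thesis)
  case 0
  then show ?case
    by (meson not_less_zero zero_less_one)
next
  case (Suc m)
  obtain \<tau> where \<tau>: "0 < \<tau>" "\<And>x y i. x \<in> X \<Longrightarrow> y \<in> X \<Longrightarrow> dist x y < \<tau> \<Longrightarrow> i < m \<Longrightarrow>
    dist ((f ^^ i) x) ((f ^^ i) y) < \<epsilon>"
    using Suc.IH by blast
  have "uniformly_continuous_on X (f ^^ m)"
    by (rule compact_uniformly_continuous[OF continuous_on_funpow compact_X])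
  then obtain d where d: "0 < d" "\<And>x y. x \<in> X \<Longrightarrow> y \<in> X \<Longrightarrow> dist x y < d \<Longrightarrow>
      dist ((f ^^ m) x) ((f ^^ m) y) < \<epsilon>"
    using assms unfolding uniformly_continuous_on_def by meson
  show ?case
    by (rule Suc.prems[of "min \<tau> d"]) (use \<tau> d in \<open>auto simp: less_Suc_eq\<close>)
qed

text \<open>The block length \<open>m\<close> is fixed while \<open>n\<close> grows. Blocks follow
  fibres over the net \<open>F\<close>, single steps follow a net of \<open>X\<close>. Of the five
  errors \<open>\<kappa>\<close>, three enter \<open>\<rho>\<close> and two pay for the powers of
  \<open>z\<close>. The scale is \<open>\<epsilon>\<close> for shadowing inside \<open>Y\<close>,
  \<open>2 * \<epsilon>\<close> for nearby points of \<open>X\<close>, and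
  \<open>4 * \<epsilon>\<close> for diameters.\<close>

lemma limsup_spanning_sum_le:
  assumes \<epsilon>: "0 < \<epsilon>" and \<kappa>: "0 < \<kappa>" and F: "finite F" "F \<subseteq> Y"
    and net: "\<And>n x. x \<in> Y \<Longrightarrow> \<exists>y\<in>(\<Union>z\<in>F. preimage n z). \<forall>i<n. dist ((f ^^ i) x) ((f ^^ i) y) < \<epsilon>"
    and \<phi>: "\<And>x y. x \<in> X \<Longrightarrow> y \<in> X \<Longrightarrow> dist x y < 2 * \<epsilon> \<Longrightarrow> \<phi> x \<le> \<phi> y + \<kappa>"
    and m: "0 < m" "real (card F) \<le> exp \<kappa> ^ m"
    and c: "0 < c" "spectral_sum m \<le> ennreal c"
  shows "limsup (\<lambda>n. spanning_sum n (4 * \<epsilon>)) \<le> ennreal (exp (5 * \<kappa>) * c)"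
proof -
  define E where "E = (\<Union>z\<in>F. preimage m z)"
  have E: "finite E" "E \<subseteq> X"
    using F finite_preimage essential_subset by (auto simp: E_def preimage_eq)
  have fibre: "(\<Sum>y\<in>preimage m z. weight m y) \<le> c ^ m" if "z \<in> F" for z
  proof -
    have "root_ennreal m (\<Sum>\<^sub>\<infinity>y\<in>preimage m z. ennreal (weight m y)) \<le> ennreal c"
      using that F c(2) unfolding spectral_sum_def by (auto simp: SUP_le_iff)
    then have "(\<Sum>\<^sub>\<infinity>y\<in>preimage m z. ennreal (weight m y)) \<le> ennreal (c ^ m)"
      using m c by (subst (asm) root_ennreal_le_iff) auto
    then show ?thesis
      using c(1) by (simp add: finite_preimage ennreal_le_iff)
  qed
  have "(\<Sum>y\<in>E. weight m y) \<le> (\<Sum>z\<in>F. \<Sum>y\<in>preimage m z. weight m y)"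
    unfolding E_def using F finite_preimage
    by (subst sum.UNION_disjoint) (auto simp: preimage_eq)
  also have "\<dots> \<le> real (card F) * c ^ m"
    using sum_bounded_above[of F, OF fibre] by simp
  also have "\<dots> \<le> exp \<kappa> ^ m * c ^ m"
    using m c by (intro mult_right_mono) auto
  finally have sum_E: "(\<Sum>y\<in>E. weight m y) \<le> (exp \<kappa> * c) ^ m"
    by (simp add: power_mult_distrib)
  \<comment> \<open>The three factors \<open>exp \<kappa>\<close> account for the number of net
    points, for the variation of the potential along blocks, and for the share
    \<open>1 - \<theta> = exp (- \<kappa>) ^ m\<close> left to blocks.\<close>
  define \<rho> where "\<rho> = exp \<kappa> * (exp \<kappa> * (exp \<kappa> * c))"
  define \<theta> where "\<theta> = 1 - exp (- \<kappa>) ^ m"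
  have \<rho>: "0 < \<rho>"
    using c by (simp add: \<rho>_def)
  have \<theta>: "0 < \<theta>" "\<theta> \<le> 1"
    using \<kappa> m by (auto simp: \<theta>_def power_less_one_iff)
  have "(\<Sum>e\<in>E. exp \<kappa> ^ m * weight m e) \<le> exp \<kappa> ^ m * (exp \<kappa> * c) ^ m"
    using sum_E by (simp add: sum_distrib_left[symmetric])
  also have "\<dots> = (1 - \<theta>) * \<rho> ^ m"
    by (simp add: \<theta>_def \<rho>_def power_mult_distrib[symmetric] mult.assoc[symmetric] exp_minus)
  finally have R: "(\<Sum>e\<in>E. exp \<kappa> ^ m * weight m e) \<le> (1 - \<theta>) * \<rho> ^ m" .
  obtain D where D: "finite D" "D \<subseteq> X" "\<And>x. x \<in> X \<Longrightarrow> \<exists>y\<in>D. dist x y < 2 * \<epsilon>"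
    using compact_finite_net[OF compact_X, of "2 * \<epsilon>"] \<epsilon> by auto
  define Q where "Q = (\<Sum>y\<in>D. exp (\<phi> y + \<kappa>))"
  have Q: "0 \<le> Q"
    unfolding Q_def by (intro sum_nonneg) auto
  \<comment> \<open>The discount brings the total mass \<open>Q\<close> of single steps down to
    \<open>\<theta> * \<rho>\<close>; adding 1 keeps the denominator positive.\<close>
  define z where "z = min 1 (\<theta> * \<rho> / (Q + 1))"
  have z: "0 < z" "z \<le> 1"
    using \<theta> \<rho> Q by (auto simp: z_def)
  have "(\<Sum>y\<in>D. z * exp (\<phi> y + \<kappa>)) = z * Q"
    by (simp add: Q_def sum_distrib_left)
  also have "\<dots> \<le> (\<theta> * \<rho> / (Q + 1)) * (Q + 1)"
    using Q z by (intro mult_mono) (auto simp: z_def)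
  also have "\<dots> = \<theta> * \<rho>"
    using Q by simp
  finally have zQ: "(\<Sum>y\<in>D. z * exp (\<phi> y + \<kappa>)) \<le> \<theta> * \<rho>" .
  obtain \<tau> where \<tau>: "0 < \<tau>" "\<And>x y i. x \<in> X \<Longrightarrow> y \<in> X \<Longrightarrow> dist x y < \<tau> \<Longrightarrow> i < m \<Longrightarrow>
      dist ((f ^^ i) x) ((f ^^ i) y) < \<epsilon>"
    using uniform_orbit_continuity[OF \<epsilon>] by blast
  \<comment> \<open>Outside \<open>K\<close> some essential point is \<open>\<tau>\<close>-close, so
    the orbit follows it for a whole block. Being compact and disjoint from \<open>Y\<close>, the
    set \<open>K\<close> is rarely visited.\<close>
  define K where "K = X - (\<Union>y\<in>Y. ball y \<tau>)"
  have K: "compact K" "K \<subseteq> X" "K \<inter> Y = {}"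
    using \<tau>(1) compact_X unfolding K_def by (auto intro!: compact_diff)
  have cover_E: "\<exists>e\<in>E. \<forall>i<m. dist ((f ^^ i) x) ((f ^^ i) e) < 2 * \<epsilon>" if x: "x \<in> X - K" for x
  proof -
    obtain y where y: "y \<in> Y" "dist x y < \<tau>" and "x \<in> X"
      using x by (auto simp: K_def dist_commute)
    obtain e where e: "e \<in> E" "\<forall>i<m. dist ((f ^^ i) y) ((f ^^ i) e) < \<epsilon>"
      using net[OF y(1), of m] unfolding E_def by blast
    have "dist ((f ^^ i) x) ((f ^^ i) e) < 2 * \<epsilon>" if "i < m" for i
    proof -
      have "dist ((f ^^ i) x) ((f ^^ i) y) < \<epsilon>"
        using \<tau>(2)[of x y i] y \<open>x \<in> X\<close> that essential_subset by auto
      moreover have "dist ((f ^^ i) y) ((f ^^ i) e) < \<epsilon>"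
        using e(2) that by blast
      ultimately show ?thesis
        using dist_triangle[of "(f ^^ i) x" "(f ^^ i) e" "(f ^^ i) y"] by simp
    qed
    then show ?thesis
      using e(1) by blast
  qed
  define L where "L = - ln z"
  have L: "0 \<le> L" "z = exp (- L)"
    using z by (auto simp: L_def)
  \<comment> \<open>With this frequency the visits cost at most
    \<open>exp (- L * \<delta> * n)\<close>-fold, which is no less than
    \<open>exp (- \<kappa> * n)\<close>; \<open>L + 1\<close> also covers the case
    \<open>z = 1\<close>.\<close>
  define \<delta> where "\<delta> = \<kappa> / (L + 1)"
  have "0 < \<delta>"
    using \<kappa> L by (simp add: \<delta>_def)
  then obtain N where N: "\<And>n x. N \<le> n \<Longrightarrow> x \<in> X \<Longrightarrow>
      (\<Sum>i<n. indicat_real K ((f ^^ i) x)) \<le> \<delta> * real n"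
    using inessential_visits[OF K] by blast
  \<comment> \<open>The first condition on \<open>n\<close> absorbs \<open>z ^ m\<close>, the price
    of the single steps at the end of an orbit; the second makes the visit bound available.\<close>
  have "\<forall>\<^sub>F n in sequentially. spanning_sum n (4 * \<epsilon>) \<le> ennreal (exp (5 * \<kappa>) * c)"
    using eventually_le_exp_power[OF \<kappa>, of "1 / z ^ m"] eventually_ge_at_top[of N]
      eventually_gt_at_top[of 0]
  proof eventually_elim
    case (elim n)
    obtain \<C> where good: "finite \<C> \<and> X \<subseteq> \<Union>(fst ` \<C>) \<and> (\<Sum>p\<in>\<C>. snd p) \<le> \<rho> ^ n \<and>
        (\<forall>(C, v)\<in>\<C>. C \<subseteq> X \<and> 0 \<le> v \<and>
          (\<forall>x\<in>C. \<forall>y\<in>C. \<forall>i<n. dist ((f ^^ i) x) ((f ^^ i) y) < 2 * (2 * \<epsilon>)) \<and>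
          (\<forall>x\<in>C. weight n x * z ^ (visits f K n x + min n m) \<le> v))"
      using weighted_covers[OF E D(1,2) m(1) cover_E D(3) \<phi> z \<rho> R zQ less_imp_le[OF \<theta>(1)] \<theta>(2), where n=n]
      by (rule exE)
    note \<C> = conjunct1[OF good] conjunct1[OF conjunct2[OF good]]
      conjunct1[OF conjunct2[OF conjunct2[OF good]]]
    note \<C>_all = conjunct2[OF conjunct2[OF conjunct2[OF good]]]
    have \<C>_C: "C \<subseteq> X" "0 \<le> v"
      "\<And>x y i. x \<in> C \<Longrightarrow> y \<in> C \<Longrightarrow> i < n \<Longrightarrow> dist ((f ^^ i) x) ((f ^^ i) y) < 4 * \<epsilon>"
      "\<And>x. x \<in> C \<Longrightarrow> weight n x * z ^ (visits f K n x + min n m) \<le> v"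
      if "(C, v) \<in> \<C>" for C v
      using bspec[OF \<C>_all that] by auto
    have z_pow: "exp (- \<kappa>) ^ n * exp (- \<kappa>) ^ n \<le> z ^ (visits f K n x + min n m)" if "x \<in> X" for x
    proof -
      have "L * real (visits f K n x) \<le> L * (\<delta> * real n)"
        using N[OF elim(2) that] L(1) by (intro mult_left_mono) (auto simp: real_visits)
      also have "\<dots> \<le> \<kappa> * real n"
        using L(1) \<kappa> by (simp add: \<delta>_def field_simps)
      finally have "exp (- (\<kappa> * real n)) \<le> exp (- (L * real (visits f K n x)))"
        by simp
      then have 1: "exp (- \<kappa>) ^ n \<le> z ^ visits f K n x"
        by (simp add: L(2) exp_of_nat_mult[symmetric] mult.commute)
      have "exp (- \<kappa>) ^ n \<le> z ^ m"
        using elim(1) z by (simp add: exp_minus field_simps)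
      also have "\<dots> \<le> z ^ min n m"
        using z by (intro power_decreasing) auto
      finally have 2: "exp (- \<kappa>) ^ n \<le> z ^ min n m" .
      show ?thesis
        unfolding power_add using 1 2 z by (intro mult_mono) auto
    qed
    show ?case
    proof (rule spanning_sum_le[OF elim(3) \<C>])
      show "x \<in> X \<and> weight n x * (exp (- \<kappa>) ^ n * exp (- \<kappa>) ^ n) \<le> v"
        if "(C, v) \<in> \<C>" "x \<in> C" for C v x
      proof
        show "x \<in> X"
          using \<C>_C(1)[OF that(1)] that(2) by blast
        then have "weight n x * (exp (- \<kappa>) ^ n * exp (- \<kappa>) ^ n)
            \<le> weight n x * z ^ (visits f K n x + min n m)"
          by (intro mult_left_mono z_pow) auto
        also have "\<dots> \<le> v"
          by (rule \<C>_C(4)[OF that])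
        finally show "weight n x * (exp (- \<kappa>) ^ n * exp (- \<kappa>) ^ n) \<le> v" .
      qed
      have "\<rho> = exp (- \<kappa>) * exp (- \<kappa>) * (exp (5 * \<kappa>) * c)"
        by (simp add: \<rho>_def exp_add[symmetric] mult.assoc[symmetric])
      then show "\<rho> ^ n \<le> exp (- \<kappa>) ^ n * exp (- \<kappa>) ^ n * (exp (5 * \<kappa>) * c) ^ n"
        by (simp add: power_mult_distrib)
    qed (use \<C>_C c in auto)
  qed
  then show ?thesis
    by (rule Limsup_bounded)
qed

text \<open>The fibre over \<open>(f ^^ n) y\<close> contains \<open>y\<close>. Positivity lets a
  finite spectral sum serve as the constant \<open>c\<close> of
  \<open>limsup_spanning_sum_le\<close>.\<close>

lemma spectral_sum_pos: "0 < spectral_sum n" if "0 < n"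
proof -
  obtain y where y: "y \<in> Y"
    using essential_nonempty by blast
  let ?x = "(f ^^ n) y"
  have "(\<Sum>z\<in>{y}. ennreal (weight n z)) \<le> (\<Sum>\<^sub>\<infinity>z\<in>preimage n ?x. ennreal (weight n z))"
    using y by (intro sum_le_infsum_ennreal) (auto simp: preimage_eq)
  then have "\<not> (\<Sum>\<^sub>\<infinity>z\<in>preimage n ?x. ennreal (weight n z)) \<le> ennreal (0 ^ n)"
    using weight_pos[of n y] that by (auto simp: zero_power)
  then have "\<not> root_ennreal n (\<Sum>\<^sub>\<infinity>z\<in>preimage n ?x. ennreal (weight n z)) \<le> ennreal 0"
    using root_ennreal_le_iff[OF that, of 0] by blast
  then have "0 < root_ennreal n (\<Sum>\<^sub>\<infinity>z\<in>preimage n ?x. ennreal (weight n z))"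
    unfolding not_le ennreal_0 .
  also have "\<dots> \<le> spectral_sum n"
    unfolding spectral_sum_def using funpow_essential[OF y] by (intro SUP_upper) auto
  finally show ?thesis .
qed

text \<open>The net \<open>F\<close> depends on the scale and on \<open>\<kappa>\<close> but not on
  \<open>m\<close>, so its cardinality is absorbed for every large \<open>m\<close>. An infinite
  spectral sum makes the bound trivial.\<close>

lemma limsup_spanning_sum_le_spectral_sum:
  assumes \<epsilon>: "0 < \<epsilon>" and \<kappa>: "0 < \<kappa>"
  shows "\<forall>\<^sub>F m in sequentially. ennreal (exp (- \<kappa>)) * limsup (\<lambda>n. spanning_sum n \<epsilon>) \<le> spectral_sum m"
proof -
  define \<kappa>' where "\<kappa>' = \<kappa> / 5"
  have \<kappa>': "0 < \<kappa>'"
    using \<kappa> by (simp add: \<kappa>'_def)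
  obtain \<epsilon>1 where \<epsilon>1: "0 < \<epsilon>1" "\<And>x y. x \<in> X \<Longrightarrow> y \<in> X \<Longrightarrow> dist x y < \<epsilon>1 \<Longrightarrow> \<phi> x \<le> \<phi> y + \<kappa>'"
    using uniform_potential[OF \<kappa>'] by blast
  define \<epsilon>' where "\<epsilon>' = min (\<epsilon> / 4) (\<epsilon>1 / 2)"
  have \<epsilon>': "0 < \<epsilon>'" "4 * \<epsilon>' \<le> \<epsilon>" "2 * \<epsilon>' \<le> \<epsilon>1"
    using \<epsilon> \<epsilon>1 by (auto simp: \<epsilon>'_def)
  obtain F where F: "finite F" "F \<subseteq> Y"
    "\<And>n x. x \<in> Y \<Longrightarrow> \<exists>y\<in>(\<Union>z\<in>F. preimage n z). \<forall>i<n. dist ((f ^^ i) x) ((f ^^ i) y) < \<epsilon>'"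
    using preimages_of_net[OF \<epsilon>'(1)] by blast
  show ?thesis
    using eventually_le_exp_power[OF \<kappa>', of "card F"] eventually_gt_at_top[of 0]
  proof eventually_elim
    case (elim m)
    show ?case
    proof (cases "spectral_sum m")
      case (real c)
      then have "0 < c"
        using spectral_sum_pos[OF elim(2)] by simp
      \<comment> \<open>Sets spanning at the finer scale also span at scale
        \<open>\<epsilon>\<close>, so the infimum at \<open>\<epsilon>\<close> is the smaller
        one.\<close>
      have "limsup (\<lambda>n. spanning_sum n \<epsilon>) \<le> limsup (\<lambda>n. spanning_sum n (4 * \<epsilon>'))"
      proof (rule Limsup_mono, rule always_eventually, rule allI)
        fix n
        have "spanning X f n \<epsilon> E" if "spanning X f n (4 * \<epsilon>') E" for E
          using that \<epsilon>'(2) unfolding spanning_def by (meson less_le_trans)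
        then show "spanning_sum n \<epsilon> \<le> spanning_sum n (4 * \<epsilon>')"
          unfolding spanning_sum_def by (intro INF_superset_mono) auto
      qed
      also have "\<dots> \<le> ennreal (exp (5 * \<kappa>') * c)"
      proof (rule limsup_spanning_sum_le[OF \<epsilon>'(1) \<kappa>' F])
        show "\<phi> x \<le> \<phi> y + \<kappa>'" if "x \<in> X" "y \<in> X" "dist x y < 2 * \<epsilon>'" for x y
          using \<epsilon>1(2) \<epsilon>'(3) that by simp
      qed (use elim \<open>0 < c\<close> real in auto)
      finally have "ennreal (exp (- \<kappa>)) * limsup (\<lambda>n. spanning_sum n \<epsilon>)
          \<le> ennreal (exp (- \<kappa>)) * ennreal (exp (5 * \<kappa>') * c)"
        by (rule mult_left_mono) simp
      also have "\<dots> = ennreal c"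
        using \<open>0 < c\<close> by (simp add: ennreal_mult[symmetric] mult.assoc[symmetric] exp_add[symmetric] \<kappa>'_def)
      finally show ?thesis
        using real by simp
    qed simp
  qed
qed

text \<open>One threshold for \<open>\<epsilon>\<close> works for all positive \<open>n\<close>, and
  multiplication by a finite constant, being continuous and monotone, commutes with the limit
  superior.\<close>

lemma limsup_spectral_sum_le:
  assumes "0 < \<kappa>"
  shows "\<forall>\<^sub>F \<epsilon> in at_right 0.
    ennreal (exp (- \<kappa>)) * limsup spectral_sum \<le> limsup (\<lambda>n. spanning_sum n \<epsilon>)"
proof -
  obtain \<epsilon>0 where \<epsilon>0: "0 < \<epsilon>0" "\<And>n \<epsilon>. 0 < n \<Longrightarrow> \<epsilon> < \<epsilon>0 \<Longrightarrow>
      ennreal (exp (- \<kappa>)) * spectral_sum n \<le> spanning_sum n \<epsilon>"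
    using spectral_sum_le_spanning_sum[OF assms] by metis
  have "\<forall>\<^sub>F \<epsilon> in at_right 0. \<epsilon> < \<epsilon>0"
    using \<epsilon>0(1) eventually_at_right_field by blast
  then show ?thesis
  proof eventually_elim
    case (elim \<epsilon>)
    have "continuous_on UNIV (\<lambda>s. ennreal (exp (- \<kappa>)) * s)"
      unfolding continuous_on_def by (intro ballI tendsto_mult_ennreal tendsto_const tendsto_ident_at) auto
    then have "ennreal (exp (- \<kappa>)) * limsup spectral_sum
        = limsup (\<lambda>n. ennreal (exp (- \<kappa>)) * spectral_sum n)"
      by (rule Limsup_compose_continuous_mono[symmetric]) (auto intro!: monoI mult_left_mono)
    also have "\<dots> \<le> limsup (\<lambda>n. spanning_sum n \<epsilon>)"
      using \<epsilon>0(2) elim by (intro Limsup_mono eventually_mono[OF eventually_gt_at_top[of 0]]) auto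
    finally show ?case .
  qed
qed

section \<open>Convergence of the spectral sums and the value of the pressure\<close>

lemma spectral_sum_tendsto: "spectral_sum \<longlonglongrightarrow> limsup spectral_sum"
  by (rule limsup_squeeze(1)[OF limsup_spectral_sum_le limsup_spanning_sum_le_spectral_sum])

lemma pressure_eq: "pressure X f \<phi> = ln_ennreal (limsup spectral_sum)"
proof -
  have "((\<lambda>\<epsilon>. limsup (\<lambda>n. spanning_sum n \<epsilon>)) \<longlongrightarrow> limsup spectral_sum) (at_right 0)"
    by (rule limsup_squeeze(2)[OF limsup_spectral_sum_le limsup_spanning_sum_le_spectral_sum])
  then have "Lim (at_right 0) (\<lambda>\<epsilon>. limsup (\<lambda>n. spanning_sum n \<epsilon>)) = limsup spectral_sum"
    by (intro tendsto_Lim) auto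
  then show ?thesis
    by (simp add: pressure_def spanning_sum_def weight_def)
qed

lemma pressure_eq_lim: "pressure X f \<phi> = ln_ennreal (lim spectral_sum)"
  by (simp add: pressure_eq limI[OF spectral_sum_tendsto])

end

text \<open>For the zero potential all weights are 1, so the sums over the finite fibres are
  cardinalities. The rate is defined by a limit superior and therefore matches
  \<open>pressure_eq\<close> directly.\<close>

lemma (in expanding_system) entropy_eq_inverse_rami_rate: "entropy X f = inverse_rami_rate X f"
proof -
  interpret expanding_potential X f "\<lambda>_. 0"
    by unfold_locales simp
  have "spectral_sum = (\<lambda>n. SUP x\<in>Y. root_ennreal n (ecard (preimage n x)))"
    by (simp add: spectral_sum_def weight_def finite_preimage ecard_finite ennreal_of_nat_eq_real_of_nat fun_eq_iff)
  then show ?thesis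
    by (simp add: entropy_def pressure_eq inverse_rami_rate_def)
qed

lemma (in expanding_system) pressure_eq_essential_spectral_potential:
  assumes a: "continuous_on X a" "\<And>x. x \<in> X \<Longrightarrow> 0 < a x"
  shows "pressure X f (\<lambda>x. ln (a x)) = essential_spectral_potential X f a"
proof -
  interpret expanding_potential X f "\<lambda>x. ln (a x)"
  proof unfold_locales
    show "continuous_on X (\<lambda>x. ln (a x))"
      by (rule continuous_on_ln[OF a(1)]) (use less_imp_neq[OF a(2)] in fastforce)
  qed
  \<comment> \<open>Positivity of \<open>a\<close> is known only on \<open>X\<close>; orbits of
    fibre points remain there, so \<open>exp (ln (a x))\<close> may be replaced by
    \<open>a x\<close>.\<close>
  have "weight n y = (\<Prod>i<n. a ((f ^^ i) y))" if "y \<in> preimage n x" for n x y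
    unfolding weight_def using that a(2) essential_subset
    by (intro prod.cong) (auto simp: preimage_eq funpow_in subset_iff)
  then have "spectral_sum = (\<lambda>n. SUP x\<in>Y. root_ennreal n (\<Sum>\<^sub>\<infinity>y\<in>preimage n x.
      ennreal (\<Prod>i<n. a ((f ^^ i) y))))"
    unfolding spectral_sum_def by (intro ext SUP_cong refl arg_cong2[where f=root_ennreal] infsum_cong) simp
  then show ?thesis
    by (simp add: pressure_eq_lim essential_spectral_potential_def)
qed

theorem theorem15:
  fixes X :: "'a::metric_space set" and \<alpha> :: "'a \<Rightarrow> 'a"
  assumes "compact X" and "X \<noteq> {}"
    and "continuous_on X \<alpha>" and "\<alpha> ` X \<subseteq> X"
    and "local_homeomorphism_on (essential_points X \<alpha>) (essential_points X \<alpha>) \<alpha>"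
    and "non_contracting_on (essential_points X \<alpha>) \<alpha>"
  shows "(forward_entropy X \<alpha> = 0 \<and> entropy X \<alpha> = inverse_rami_rate X \<alpha>) \<and>
         (\<forall>a :: 'a \<Rightarrow> real. continuous_on X a \<and> (\<forall>x\<in>X. a x > 0) \<longrightarrow>
            pressure X \<alpha> (\<lambda>x. ln (a x)) = essential_spectral_potential X \<alpha> a)"
proof -
  interpret expanding_system X \<alpha>
    by unfold_locales (fact assms)+
  show ?thesis
    using forward_entropy_eq_0 entropy_eq_inverse_rami_rate pressure_eq_essential_spectral_potential
    by blast
qed

end
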